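(* Let $r\ge 3$ be odd, let $q$ be a prime power, let $\mathcal L$ be an $m$-cover of $\mathcal W(r,q)$ and let $\bar{\mathcal L}$ be the set of points of $\mathcal H(r,q^2)$ lying on the extended lines of $\mathcal L$. Then $\bar{\mathcal L}$ is an $(m(q^2-q)+q+1)$-tight set of $\mathcal H(r,q^2)$ if and only if $\mathcal L$ is an $(r-2)$-dual cover of symplectic type.
   Context: $\theta_{n,q}=q^n+\dots+q+1$ for $n\ge0$, $\theta_{-1,q}=0$; $\theta_{n,q^2}$ is the same expression with $q^2$ in place of $q$. $\mathcal W(r,q)$ is the symplectic polar space of $\mathrm{PG}(r,q)$ given by a nondegenerate alternating form $b$ on $\mathbb F_q^{r+1}$, with polarity $\perp$. Its points are all points of $\mathrm{PG}(r,q)$ and its lines are the totally isotropic lines. An $m$-cover of $\mathcal W(r,q)$ ($m>0$) is a set $\mathcal L$ of lines of $\mathcal W(r,q)$ such that every point lies on exactly $m$ lines of $\mathcal L$. $\mathcal L$ is $(r-2)$-dual of symplectic type if for every line $\ell$ of $\mathrm{PG}(r,q)$ the number of lines of $\mathcal L$ contained in $\ell^\perp$ equals $\frac{m\theta_{r-4,q}}{q+1}+q^{r-3}$ if $\ell\in\mathcal L$, and $\frac{m\theta_{r-4,q}}{q+1}$ if $\ell\notin\mathcal L$. $\mathrm{PG}(r,q)$ is embedded in $\mathrm{PG}(r,q^2)$ by extension of scalars; the extended line of a line $\ell$ of $\mathrm{PG}(r,q)$ is the line of $\mathrm{PG}(r,q^2)$ containing the $q+1$ points of $\ell$. Let $\tau$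 be the semilinear involution of $\mathrm{PG}(r,q^2)$ raising coordinates to the $q$-th power (fixing $\mathrm{PG}(r,q)$ pointwise) and $B$ the $\mathbb F_{q^2}$-bilinear extension of $b$. $\mathcal H(r,q^2)$ is the non-degenerate Hermitian variety $\{\langle x\rangle : B(x,\tau(x))=0\}$, which is exactly the set of points on the extended lines of $\mathcal W(r,q)$; its unitary polarity is $\langle x\rangle^{\perp_h}=\{y: B(y,\tau(x))=0\}$. A subset $\mathcal X$ of points of $\mathcal H(r,q^2)$ is $i$-tight if for every point $P$ of $\mathcal H(r,q^2)$, $|P^{\perp_h}\cap\mathcal X|$ equals $i\,\theta_{\frac{r-3}{2},q^2}+q^{r-1}$ if $P\in\mathcal X$ and $i\,\theta_{\frac{r-3}{2},q^2}$ if $P\notin\mathcal X$. *)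

theory Defs
  imports "HOL-Analysis.Analysis"
begin

text \<open>
  The finite fields of orders \<open>q\<close> and \<open>q\<^sup>2\<close> are arbitrary types \<open>'a\<close>, \<open>'b\<close> of class
  \<open>{field, finite}\<close>; the number of elements is fixed by hypotheses. Extension of scalars is along
  a field homomorphism \<open>h :: 'a \<Rightarrow> 'b\<close>, so that the projective space over \<open>'a\<close> is not literally
  a subset of the one over \<open>'b\<close>. A projective subspace is represented by the underlying vector
  subspace (a set of vectors containing \<open>0\<close>), so a point \<open>P\<close> lies on a subspace \<open>S\<close> iff
  \<open>P \<subseteq> S\<close>.
\<close>

definition theta :: "int \<Rightarrow> nat \<Rightarrow> nat" where
  "theta n q = (\<Sum>i\<in>{0..n}. q ^ nat i)"

definition pg_points :: "('k::field ^ 'n) set set" where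
  "pg_points = {P. vec.subspace P \<and> vec.dim P = 1}"

definition pg_lines :: "('k::field ^ 'n) set set" where
  "pg_lines = {l. vec.subspace l \<and> vec.dim l = 2}"

definition bilinear_form :: "('k::field ^ 'n \<Rightarrow> 'k ^ 'n \<Rightarrow> 'k) \<Rightarrow> bool" where
  "bilinear_form b \<longleftrightarrow>
     (\<forall>x. Vector_Spaces.linear (*s) (*) (\<lambda>y. b x y)) \<and>
     (\<forall>y. Vector_Spaces.linear (*s) (*) (\<lambda>x. b x y))"

definition nondegenerate_alternating :: "('k::field ^ 'n \<Rightarrow> 'k ^ 'n \<Rightarrow> 'k) \<Rightarrow> bool" where
  "nondegenerate_alternating b \<longleftrightarrow>
     bilinear_form b \<and> (\<forall>x. b x x = 0) \<and> (\<forall>x. (\<forall>y. b x y = 0) \<longrightarrow> x = 0)"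

definition perp :: "('k::field ^ 'n \<Rightarrow> 'k ^ 'n \<Rightarrow> 'k) \<Rightarrow> ('k ^ 'n) set \<Rightarrow> ('k ^ 'n) set" where
  "perp b S = {y. \<forall>x\<in>S. b x y = 0}"

definition symplectic_lines :: "('k::field ^ 'n \<Rightarrow> 'k ^ 'n \<Rightarrow> 'k) \<Rightarrow> ('k ^ 'n) set set" where
  "symplectic_lines b = {l \<in> pg_lines. \<forall>x\<in>l. \<forall>y\<in>l. b x y = 0}"

definition m_cover ::
  "('k::{field,finite} ^ 'n \<Rightarrow> 'k ^ 'n \<Rightarrow> 'k) \<Rightarrow> nat \<Rightarrow> ('k ^ 'n) set set \<Rightarrow> bool" where
  "m_cover b m L \<longleftrightarrow>
     m > 0 \<and> L \<subseteq> symplectic_lines b \<and> (\<forall>P\<in>pg_points. card {l \<in> L. P \<subseteq> l} = m)"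

text \<open>The line \<open>l\<close> ranges over all lines of the projective space, not only the totally isotropic
  ones.\<close>

definition dual_symplectic_type ::
  "nat \<Rightarrow> nat \<Rightarrow> ('k::{field,finite} ^ 'n \<Rightarrow> 'k ^ 'n \<Rightarrow> 'k) \<Rightarrow> nat \<Rightarrow> ('k ^ 'n) set set \<Rightarrow> bool" where
  "dual_symplectic_type r q b m L \<longleftrightarrow>
     (\<forall>l\<in>pg_lines. real (card {k \<in> L. k \<subseteq> perp b l}) =
        (if l \<in> L
         then real m * real (theta (int r - 4) q) / (real q + 1) + real q ^ (r - 3)
         else real m * real (theta (int r - 4) q) / (real q + 1)))"

definition field_hom :: "('a::field \<Rightarrow> 'b::field) \<Rightarrow> bool" where
  "field_hom h \<longleftrightarrow>
     h 1 = 1 \<and> (\<forall>x y. h (x + y) = h x + h y) \<and> (\<forall>x y. h (x * y) = h x * h y)"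

definition extend_vec :: "('a \<Rightarrow> 'b) \<Rightarrow> 'a ^ 'n \<Rightarrow> 'b ^ 'n" where
  "extend_vec h x = (\<chi> i. h (x $ i))"

definition extended_line :: "('a::field \<Rightarrow> 'b::field) \<Rightarrow> ('a ^ 'n) set \<Rightarrow> ('b ^ 'n) set" where
  "extended_line h l = vec.span (extend_vec h ` l)"

text \<open>The bilinear form over \<open>'b\<close> with the same Gram matrix as \<open>b\<close> in the standard basis.\<close>

definition extend_form ::
  "('a::field \<Rightarrow> 'b::field) \<Rightarrow> ('a ^ 'n \<Rightarrow> 'a ^ 'n \<Rightarrow> 'a) \<Rightarrow> 'b ^ 'n \<Rightarrow> 'b ^ 'n \<Rightarrow> 'b" where
  "extend_form h b x y = (\<Sum>i\<in>UNIV. \<Sum>j\<in>UNIV. x $ i * h (b (axis i 1) (axis j 1)) * y $ j)"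

definition tau :: "nat \<Rightarrow> 'b::field ^ 'n \<Rightarrow> 'b ^ 'n" where
  "tau q x = (\<chi> i. (x $ i) ^ q)"

definition hermitian_variety ::
  "nat \<Rightarrow> ('a::field \<Rightarrow> 'b::field) \<Rightarrow> ('a ^ 'n \<Rightarrow> 'a ^ 'n \<Rightarrow> 'a) \<Rightarrow> ('b ^ 'n) set set" where
  "hermitian_variety q h b = {P \<in> pg_points. \<forall>x\<in>P. extend_form h b x (tau q x) = 0}"

definition unitary_perp ::
  "nat \<Rightarrow> ('a::field \<Rightarrow> 'b::field) \<Rightarrow> ('a ^ 'n \<Rightarrow> 'a ^ 'n \<Rightarrow> 'a) \<Rightarrow> ('b ^ 'n) set \<Rightarrow> ('b ^ 'n) set" where
  "unitary_perp q h b P = {y. \<forall>x\<in>P. extend_form h b y (tau q x) = 0}"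

text \<open>The exponent \<open>(r - 3) / 2\<close> is exact, because \<open>r\<close> is odd wherever this is used.\<close>

definition tight_set ::
  "nat \<Rightarrow> nat \<Rightarrow> ('a::{field,finite} \<Rightarrow> 'b::{field,finite}) \<Rightarrow> ('a ^ 'n \<Rightarrow> 'a ^ 'n \<Rightarrow> 'a)
     \<Rightarrow> nat \<Rightarrow> ('b ^ 'n) set set \<Rightarrow> bool" where
  "tight_set r q h b i X \<longleftrightarrow>
     X \<subseteq> hermitian_variety q h b \<and>
     (\<forall>P\<in>hermitian_variety q h b. card {Q \<in> X. Q \<subseteq> unitary_perp q h b P} =
        (if P \<in> X
         then i * theta ((int r - 3) div 2) (q\<^sup>2) + q ^ (r - 1)
         else i * theta ((int r - 3) div 2) (q\<^sup>2)))"

definition cover_points ::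
  "nat \<Rightarrow> ('a::field \<Rightarrow> 'b::field) \<Rightarrow> ('a ^ 'n \<Rightarrow> 'a ^ 'n \<Rightarrow> 'a) \<Rightarrow> ('a ^ 'n) set set
     \<Rightarrow> ('b ^ 'n) set set" where
  "cover_points q h b L = {P \<in> hermitian_variety q h b. \<exists>l\<in>L. P \<subseteq> extended_line h l}"

end

theory Submission
  imports Defs
begin

text \<open>
  Choose \<open>w \<in> GF(q\<^sup>2) - GF(q)\<close>, so that every vector over \<open>GF(q\<^sup>2)\<close> is \<open>u + w v\<close> with unique rational
  \<open>u, v\<close>; it lies on the extension of a line \<open>k\<close> iff \<open>u, v \<in> k\<close>. For the point \<open>P = \<langle>u + w v\<rangle>\<close>, the extension
  of \<open>k\<close> lies in the unitary perp of \<open>P\<close> if \<open>k\<close> lies in the symplectic perp of \<open>{u, v}\<close>, and meets it in one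
  point otherwise. Counting incidences between the perp of \<open>P\<close> and the extended lines of the cover
  turns the tightness condition at \<open>P\<close> into the condition on the number \<open>c(u, v)\<close> of lines of the
  cover in \<open>{u, v}\<^sup>\<perp>\<close>; it holds automatically when \<open>P\<close> is rational.

  Tightness says nothing about the lines that are not totally isotropic. For these, the sums of
  \<open>c\<close> and of \<open>c\<^sup>2\<close> over all pairs \<open>(u, v)\<close> depend only on the parameters of the cover. If \<open>c\<close> is as
  prescribed on the pairs that span a line of the cover, the sum of \<open>(c - A)\<^sup>2\<close> over the pairs that
  span any other line is \<open>0\<close>, where \<open>A\<close> is the prescribed value there.
\<close>

section \<open>Counting in finite vector spaces\<close>

lemma card_field_gt_1: "CARD('k::{field,finite}) > 1"
proof -
  have "card {0, 1 :: 'k} \<le> CARD('k)" by (rule card_mono) auto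
  then show ?thesis by simp
qed

text \<open>Each vector of the larger span is \<open>k *s a + x\<close> for exactly one scalar
  \<open>k\<close> and one \<open>x\<close> in the smaller span, so every basis vector contributes a
  factor \<open>CARD('k)\<close>.\<close>

lemma card_span_independent:
  fixes B :: "('k::{field,finite} ^ 'n) set"
  assumes "vec.independent B"
  shows "card (vec.span B) = CARD('k) ^ card B"
proof -
  have "finite B" by simp
  then show ?thesis using assms
  proof (induction B)
    case empty
    then show ?case by simp
  next
    case (insert a B)
    have a: "a \<notin> vec.span B" and B: "vec.independent B"
      using insert.prems insert.hyps by (auto simp: vec.independent_insert)
    have eq: "vec.span (insert a B) = (\<lambda>(k, x). k *s a + x) ` (UNIV \<times> vec.span B)"
    proof (intro set_eqI iffI)
      fix x assume "x \<in> vec.span (insert a B)"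
      then obtain k where "x - k *s a \<in> vec.span B" by (auto simp: vec.span_insert)
      then show "x \<in> (\<lambda>(k, x). k *s a + x) ` (UNIV \<times> vec.span B)"
        by (intro image_eqI[of _ _ "(k, x - k *s a)"]) auto
    next
      fix x assume "x \<in> (\<lambda>(k, x). k *s a + x) ` (UNIV \<times> vec.span B)"
      then obtain k y where "y \<in> vec.span B" "x = k *s a + y" by auto
      then show "x \<in> vec.span (insert a B)" by (auto simp: vec.span_insert intro!: exI[of _ k])
    qed
    have "inj_on (\<lambda>(k, x). k *s a + x) (UNIV \<times> vec.span B)"
    proof (rule inj_onI, clarify)
      fix k x k' x' assume x: "x \<in> vec.span B" "x' \<in> vec.span B" and e: "k *s a + x = k' *s a + x'"
      have "(k - k') *s a = x' - x" using e by (simp add: algebra_simps vec.scale_left_diff_distrib)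
      then have *: "(k - k') *s a \<in> vec.span B" using x by (simp add: vec.span_diff)
      have "k = k'"
      proof (rule ccontr)
        assume "k \<noteq> k'"
        then have "a = inverse (k - k') *s ((k - k') *s a)"
          by (simp only: vec.scale_scale) simp
        then show False using a vec.span_scale[OF *, of "inverse (k - k')"] by metis
      qed
      then show "k = k' \<and> x = x'" using e by simp
    qed
    then have "card (vec.span (insert a B)) = card ((UNIV :: 'k set) \<times> vec.span B)"
      unfolding eq by (rule card_image)
    then show ?case using insert B by (simp add: card_cartesian_product)
  qed
qed

lemma card_subspace:
  fixes S :: "('k::{field,finite} ^ 'n) set"
  assumes "vec.subspace S"
  shows "card S = CARD('k) ^ vec.dim S"
proof -
  obtain B where "vec.independent B" "vec.span B = S" "card B = vec.dim S"
    using vec.basis_subspace_exists[OF assms] by metis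
  then show ?thesis using card_span_independent[of B] by simp
qed

text \<open>\<open>S\<close> is the direct sum of the line through \<open>a\<close> and the kernel
  of \<open>f\<close> on \<open>S\<close>. Linearity of \<open>f\<close> is assumed pointwise, so
  that either argument of a form can play the role of \<open>f\<close>.\<close>

lemma card_kernel:
  fixes S :: "('k::{field,finite} ^ 'n) set"
  assumes S: "vec.subspace S"
    and add: "\<And>x y. f (x + y) = f x + f y" and scale: "\<And>c x. f (c *s x) = c * f x"
    and a: "a \<in> S" "f a \<noteq> (0 :: 'k)"
  shows "card S = CARD('k) * card {x \<in> S. f x = 0}"
proof -
  let ?g = "\<lambda>(t, x). t *s a + x"
  have "bij_betw ?g (UNIV \<times> {x \<in> S. f x = 0}) S"
    unfolding bij_betw_def
  proof
    show "inj_on ?g (UNIV \<times> {x \<in> S. f x = 0})"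
    proof (rule inj_onI, clarify)
      fix t x t' x' assume 0: "f x = 0" "f x' = 0" and e: "t *s a + x = t' *s a + x'"
      from 0 have "f (t *s a + x) = t * f a" "f (t' *s a + x') = t' * f a" by (simp_all add: add scale)
      then have "t * f a = t' * f a" using e by metis
      then have "t = t'" using a by simp
      then show "t = t' \<and> x = x'" using e by simp
    qed
    show "?g ` (UNIV \<times> {x \<in> S. f x = 0}) = S"
    proof (intro set_eqI iffI)
      fix x assume x: "x \<in> S"
      let ?t = "f x / f a"
      have *: "x - ?t *s a \<in> S" by (intro vec.subspace_diff vec.subspace_scale S x a)
      have "f x = f (?t *s a + (x - ?t *s a))" by simp
      also have "\<dots> = f x + f (x - ?t *s a)" using a by (simp only: add scale) simp
      finally have "f (x - ?t *s a) = 0" by simp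
      then show "x \<in> ?g ` (UNIV \<times> {x \<in> S. f x = 0})" using *
        by (intro image_eqI[of _ _ "(?t, x - ?t *s a)"]) auto
    qed (auto intro!: vec.subspace_add vec.subspace_scale S a)
  qed
  from bij_betw_same_card[OF this] show ?thesis by (simp add: card_cartesian_product)
qed

section \<open>Linearly dependent pairs, projective lines and projective points\<close>

text \<open>Linear dependence of an ordered pair. The asymmetric form lists each dependent pair
  once: either \<open>u = 0\<close> and \<open>v\<close> is free, or \<open>u\<close> is nonzero and
  \<open>v\<close> is determined by a scalar.\<close>

definition collinear_pair :: "'k::field ^ 'n \<Rightarrow> 'k ^ 'n \<Rightarrow> bool" where
  "collinear_pair u v \<longleftrightarrow> u = 0 \<or> (\<exists>t. v = t *s u)"

text \<open>There are \<open>card U\<close> pairs with \<open>u = 0\<close>, and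
  \<open>CARD('k)\<close> multiples of each nonzero \<open>u\<close>. The summand on the left avoids
  a subtraction of natural numbers.\<close>

lemma card_collinear_pairs:
  fixes U :: "('k::{field,finite} ^ 'n) set"
  assumes U: "vec.subspace U"
  shows "card {(u, v). u \<in> U \<and> v \<in> U \<and> collinear_pair u v} + CARD('k) = (CARD('k) + 1) * card U"
proof -
  have 0: "0 \<in> U" using U by (rule vec.subspace_0)
  let ?g = "\<lambda>(u, t :: 'k). (u, t *s u)"
  have eq: "{(u, v). u \<in> U \<and> v \<in> U \<and> collinear_pair u v} = {0} \<times> U \<union> ?g ` ((U - {0}) \<times> UNIV)"
    using 0 by (auto simp: collinear_pair_def intro: vec.subspace_scale[OF U])
  have inj: "inj_on ?g ((U - {0}) \<times> UNIV)"
    by (rule inj_onI) auto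
  have "finite ({0 :: 'k ^ 'n} \<times> U)" "finite (?g ` ((U - {0}) \<times> UNIV))"
    "({0} \<times> U) \<inter> ?g ` ((U - {0}) \<times> UNIV) = {}"
    by auto
  then have "card ({0} \<times> U \<union> ?g ` ((U - {0}) \<times> UNIV)) = card ({0 :: 'k ^ 'n} \<times> U) + card (?g ` ((U - {0}) \<times> UNIV))"
    by (rule card_Un_disjoint)
  moreover have "card ({0 :: 'k ^ 'n} \<times> U) + card (?g ` ((U - {0}) \<times> UNIV)) = card U + (card U - 1) * CARD('k)"
    using 0 by (simp add: card_image[OF inj] card_cartesian_product)
  ultimately have "card ({0 :: 'k ^ 'n} \<times> U \<union> ?g ` ((U - {0}) \<times> UNIV)) = card U + (card U - 1) * CARD('k)"
    by (rule trans)
  moreover have "card U > 0" using 0 by (auto simp: card_gt_0_iff)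
  ultimately show ?thesis unfolding eq by (cases "card U") (auto simp: algebra_simps)
qed

text \<open>The conjunct \<open>u \<noteq> v\<close> matters: for nonzero \<open>u\<close> the set
  \<open>{u, u}\<close> is a singleton and independent, although the pair is collinear.\<close>

lemma independent_pair_iff: "u \<noteq> v \<and> vec.independent {u, v} \<longleftrightarrow> \<not> collinear_pair u v"
proof (cases "u = 0")
  case True
  then show ?thesis by (auto simp: collinear_pair_def vec.dependent_zero)
next
  case False
  have "(\<exists>t. v = t *s u) \<longleftrightarrow> v \<in> vec.span {u}" by (auto simp: vec.span_singleton)
  moreover have "v \<in> vec.span {u}" if "u = v" using that by (simp add: vec.span_base)
  ultimately show ?thesis using False
    by (cases "u = v") (auto simp: collinear_pair_def vec.independent_insert insert_commute[of u])
qed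

lemma span_pair_in_lines:
  assumes "\<not> collinear_pair u v"
  shows "vec.span {u, v} \<in> pg_lines"
  using assms unfolding independent_pair_iff[symmetric]
  by (simp add: pg_lines_def vec.dim_eq_card_independent)

lemma span_pair_eq_line:
  assumes "l \<in> pg_lines" "u \<in> l" "v \<in> l" "\<not> collinear_pair u v"
  shows "vec.span {u, v} = l"
proof -
  have s: "vec.subspace l" and d: "vec.dim l = 2" using assms by (auto simp: pg_lines_def)
  have i: "u \<noteq> v" "vec.independent {u, v}" using assms independent_pair_iff by auto
  show ?thesis
  proof
    show "vec.span {u, v} \<subseteq> l" using s assms by (intro vec.span_minimal) auto
    show "l \<subseteq> vec.span {u, v}" using i d assms
      by (intro vec.card_ge_dim_independent) auto
  qed
qed

lemma pg_line_spanE: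
  assumes "l \<in> pg_lines"
  obtains u v where "\<not> collinear_pair u v" "l = vec.span {u, v}"
proof -
  obtain B where B: "vec.independent B" "vec.span B = l" "card B = 2"
    using assms vec.basis_subspace_exists[of l] by (auto simp: pg_lines_def)
  then obtain u v where "B = {u, v}" "u \<noteq> v" by (meson card_2_iff)
  then show ?thesis using B that[of u v] independent_pair_iff[of u v] by auto
qed

lemma card_pg_line:
  fixes l :: "('k::{field,finite} ^ 'n) set"
  assumes "l \<in> pg_lines"
  shows "card l = CARD('k)\<^sup>2"
  using assms card_subspace[of l] by (simp add: pg_lines_def)

lemma span_singleton_in_points: "x \<noteq> 0 \<Longrightarrow> vec.span {x} \<in> pg_points"
  by (simp add: pg_points_def vec.dim_eq_card_independent)

lemma pg_point_eq_span:
  assumes "P \<in> pg_points" "x \<in> P" "x \<noteq> 0"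
  shows "P = vec.span {x}"
proof
  have s: "vec.subspace P" and d: "vec.dim P = 1" using assms by (auto simp: pg_points_def)
  show "vec.span {x} \<subseteq> P" using s assms by (intro vec.span_minimal) auto
  show "P \<subseteq> vec.span {x}" using d assms by (intro vec.card_ge_dim_independent) auto
qed

lemma pg_point_spanE:
  assumes "P \<in> pg_points"
  obtains x where "x \<noteq> 0" "P = vec.span {x}"
proof -
  have "\<not> P \<subseteq> {0}" using assms by (auto simp: pg_points_def simp flip: vec.dim_eq_0)
  then show ?thesis using that pg_point_eq_span[OF assms] by auto
qed

text \<open>Distinct points share only the zero vector. This converts a count of points into a count
  of nonzero vectors.\<close>

lemma card_Union_points:
  fixes Q :: "('k::{field,finite} ^ 'n) set set"
  assumes "Q \<subseteq> pg_points"
  shows "card (\<Union>Q - {0}) = card Q * (CARD('k) - 1)"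
proof -
  have "card (\<Union>P\<in>Q. P - {0}) = (\<Sum>P\<in>Q. card (P - {0}))"
  proof (rule card_UN_disjoint)
    show "\<forall>P\<in>Q. \<forall>R\<in>Q. P \<noteq> R \<longrightarrow> (P - {0}) \<inter> (R - {0}) = {}"
      using assms pg_point_eq_span by blast
  qed auto
  moreover have "\<dots> = (\<Sum>P\<in>Q. CARD('k) - 1)"
  proof (rule sum.cong[OF refl])
    fix P assume "P \<in> Q"
    then have P: "vec.subspace P" "vec.dim P = 1" using assms by (auto simp: pg_points_def)
    then have "card P = CARD('k)" using card_subspace[of P] by simp
    then show "card (P - {0}) = CARD('k) - 1" using vec.subspace_0[OF P(1)] by simp
  qed
  moreover have "\<Union>Q - {0} = (\<Union>P\<in>Q. P - {0})" by auto
  ultimately have "card (\<Union>Q - {0}) = (\<Sum>P\<in>Q. CARD('k) - 1)" by (simp only:)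
  then show ?thesis by simp
qed

lemma card_sum_Int:
  fixes S T :: "('k::{field,finite} ^ 'n) set"
  assumes "vec.subspace S" "vec.subspace T"
  shows "card {x + y |x y. x \<in> S \<and> y \<in> T} * card (S \<inter> T) = card S * card T"
proof -
  have "vec.subspace (S \<inter> T)" using assms by (simp add: vec.subspace_inter)
  then show ?thesis using vec.dim_sums_Int[OF assms] assms
    by (simp add: card_subspace vec.subspace_sums flip: power_add)
qed

section \<open>Alternating forms and perps\<close>

lemma alternating_form:
  assumes "nondegenerate_alternating b"
  shows form_add_right: "b x (y + z) = b x y + b x z"
    and form_scale_right: "b x (c *s y) = c * b x y"
    and form_add_left: "b (y + z) x = b y x + b z x"
    and form_scale_left: "b (c *s y) x = c * b y x"
    and form_self: "b x x = 0"
    and form_swap: "b x y = - b y x"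
    and form_nondegenerate: "x \<noteq> 0 \<Longrightarrow> \<exists>y. b x y \<noteq> 0"
proof -
  have l: "Vector_Spaces.linear (*s) (*) (\<lambda>y. b x y)" "Vector_Spaces.linear (*s) (*) (\<lambda>y. b y x)" for x
    using assms by (auto simp: nondegenerate_alternating_def bilinear_form_def)
  show ar: "b x (y + z) = b x y + b x z" and "b x (c *s y) = c * b x y" for x y z c
    using l(1)[of x] by (simp_all add: Vector_Spaces.linear_iff)
  show al: "b (y + z) x = b y x + b z x" and "b (c *s y) x = c * b y x" for x y z c
    using l(2)[of x] by (simp_all add: Vector_Spaces.linear_iff)
  show s: "b x x = 0" for x
    using assms by (auto simp: nondegenerate_alternating_def)
  have "b (x + y) (x + y) = b x y + b y x"
    unfolding ar al by (simp add: s)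
  then show "b x y = - b y x"
    by (simp add: s eq_neg_iff_add_eq_0)
  show "\<exists>y. b x y \<noteq> 0" if "x \<noteq> 0"
    using that assms by (auto simp: nondegenerate_alternating_def)
qed

lemma perp_eq:
  assumes "nondegenerate_alternating b"
  shows "perp b S = {y. \<forall>x\<in>S. b y x = 0}"
  using form_swap[OF assms] unfolding perp_def by (metis neg_equal_0_iff_equal)

lemma subspace_perp:
  assumes "nondegenerate_alternating b"
  shows "vec.subspace (perp b S)"
proof -
  have "b x 0 = 0" for x using form_scale_right[OF assms, of x 0 0] by simp
  then show ?thesis
    by (auto simp: perp_def vec.subspace_def form_add_right[OF assms] form_scale_right[OF assms])
qed

lemma subset_perp_iff:
  assumes "nondegenerate_alternating b"
  shows "S \<subseteq> perp b T \<longleftrightarrow> T \<subseteq> perp b S"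
  unfolding perp_eq[OF assms, of S] by (auto simp: perp_def)

text \<open>The double perp of \<open>S\<close> is a subspace that contains \<open>S\<close>, hence
  it contains the span of \<open>S\<close>.\<close>

lemma perp_span:
  assumes "nondegenerate_alternating b"
  shows "perp b (vec.span S) = perp b S"
proof
  show "perp b (vec.span S) \<subseteq> perp b S"
    by (auto simp: perp_def vec.span_base)
  have "S \<subseteq> perp b (perp b S)" using subset_perp_iff[OF assms] by blast
  then have "vec.span S \<subseteq> perp b (perp b S)"
    by (rule vec.span_minimal[OF _ subspace_perp[OF assms]])
  then show "perp b S \<subseteq> perp b (vec.span S)" using subset_perp_iff[OF assms] by blast
qed

text \<open>Double count the pairs \<open>(x, w)\<close> with \<open>x \<in> S\<close> and \<open>b x w = 0\<close>.\<close>

lemma card_perp: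
  fixes b :: "'k::{field,finite} ^ 'n \<Rightarrow> 'k ^ 'n \<Rightarrow> 'k"
  assumes b: "nondegenerate_alternating b" and S: "vec.subspace S"
  shows "card S * card (perp b S) = CARD('k) ^ CARD('n)"
proof -
  define q where "q = real CARD('k)"
  define N where "N = real CARD('k ^ 'n)"
  define s where "s = real (card S)"
  define t where "t = real (card (perp b S))"
  have q: "q > 1" using card_field_gt_1[where 'k = 'k] by (simp add: q_def)
  have row: "real (card {w. b x w = 0}) = (if x = 0 then N else N / q)" for x
  proof (cases "x = 0")
    case True
    have "b 0 w = 0" for w using form_scale_left[OF b, of 0 0 w] by simp
    then show ?thesis using True by (simp add: N_def)
  next
    case False
    then obtain a where "b x a \<noteq> 0" using form_nondegenerate[OF b] by blast
    then have "CARD('k ^ 'n) = CARD('k) * card {w \<in> UNIV. b x w = 0}"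
      by (intro card_kernel[of UNIV "b x" a]) (auto simp: form_add_right[OF b] form_scale_right[OF b])
    then show ?thesis using False q by (simp add: N_def q_def)
  qed
  have col: "real (card {x \<in> S. b x w = 0}) = (if w \<in> perp b S then s else s / q)" for w
  proof (cases "w \<in> perp b S")
    case True
    then have "{x \<in> S. b x w = 0} = S" by (auto simp: perp_def)
    then show ?thesis using True by (simp add: s_def)
  next
    case False
    then obtain a where "a \<in> S" "b a w \<noteq> 0" by (auto simp: perp_def)
    then have "card S = CARD('k) * card {x \<in> S. b x w = 0}"
      by (intro card_kernel[of S "\<lambda>x. b x w" a] S) (auto simp: form_add_left[OF b] form_scale_left[OF b])
    then show ?thesis using False q by (simp add: s_def q_def)
  qed
  have "(\<Sum>x\<in>S. real (card {w. b x w = 0})) = (\<Sum>x\<in>S. \<Sum>w\<in>UNIV. of_bool (b x w = 0))"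
    by (intro sum.cong refl) simp
  also have "\<dots> = (\<Sum>w\<in>UNIV. \<Sum>x\<in>S. of_bool (b x w = 0))" by (rule sum.swap)
  also have "\<dots> = (\<Sum>w\<in>UNIV. real (card {x \<in> S. b x w = 0}))"
    by (intro sum.cong refl) (simp add: Collect_conj_eq Int_commute)
  finally have "(\<Sum>x\<in>S. if x = 0 then N else N / q) = (\<Sum>w\<in>UNIV. if w \<in> perp b S then s else s / q)"
    unfolding row col .
  moreover have "(\<Sum>x\<in>S. if x = 0 then N else N / q) = N + (s - 1) * (N / q)"
  proof -
    have "0 \<in> S" using S by (rule vec.subspace_0)
    then have "(\<Sum>x\<in>S. if x = 0 then N else N / q) = N + (\<Sum>x\<in>S - {0}. N / q)"
      by (simp add: sum.remove[of S 0])
    also have "\<dots> = N + (s - 1) * (N / q)"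
      using \<open>0 \<in> S\<close> card_gt_0_iff[of S] by (auto simp: s_def of_nat_diff Suc_le_eq)
    finally show ?thesis .
  qed
  moreover have "(\<Sum>w\<in>UNIV. if w \<in> perp b S then s else s / q) = t * s + (N - t) * (s / q)"
  proof -
    have "card (- perp b S) = CARD('k ^ 'n) - card (perp b S)"
      by (simp add: Compl_eq_Diff_UNIV card_Diff_subset)
    moreover have "card (perp b S) \<le> CARD('k ^ 'n)" by (rule card_mono) auto
    ultimately show ?thesis
      by (simp add: sum.If_cases t_def N_def of_nat_diff Compl_eq)
  qed
  ultimately have "N + (s - 1) * (N / q) = t * s + (N - t) * (s / q)" by simp
  \<comment> \<open>After multiplication by \<open>q\<close> the terms \<open>s * N\<close> on both
    sides cancel.\<close>
  then have "N * (q - 1) = s * t * (q - 1)"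
    using q by (simp add: field_simps)
  then have "N = s * t" using q by simp
  then have "CARD('k ^ 'n) = card S * card (perp b S)"
    unfolding N_def s_def t_def of_nat_mult[symmetric] of_nat_eq_iff .
  then show ?thesis by (simp add: CARD_vec)
qed

lemma sum_of_bool_card: "finite A \<Longrightarrow> (\<Sum>x\<in>A. of_bool (P x)) = real (card {x \<in> A. P x})"
  by (simp add: Int_def)

lemma sum_of_bool_Times:
  fixes S :: "('k::finite ^ 'n::finite) set"
  shows "(\<Sum>p\<in>UNIV. of_bool (p \<in> S \<times> S)) = (real (card S))\<^sup>2"
  by (simp only: sum_of_bool_card finite UNIV_I simp_thms Collect_mem_eq card_cartesian_product
      of_nat_mult power2_eq_square)

text \<open>The geometric series. The boundary case \<open>n = - 1\<close>, an empty sum, occurs for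
  \<open>r = 3\<close>, where \<open>theta (int r - 4) q\<close> is 0.\<close>

lemma theta_eq: "n \<ge> - 1 \<Longrightarrow> real (theta n q) * (real q - 1) = real q ^ nat (n + 1) - 1"
proof -
  assume "n \<ge> - 1"
  then have "{0..n} = int ` {..<nat (n + 1)}"
    by (auto simp: image_iff intro!: bexI[of _ "nat _"])
  then have "theta n q = (\<Sum>i<nat (n + 1). q ^ i)"
    by (simp add: theta_def sum.reindex)
  then show ?thesis
    by (simp add: power_diff_1_eq mult.commute)
qed

section \<open>Moments of the lines in a perp\<close>

text \<open>With \<open>\<Lambda>\<close> lines in the cover and \<open>q ^ 4 * z\<close> vectors in
  the space, the left side is the sum of \<open>(c - A)\<^sup>2\<close> over all pairs of vectors,
  written through the two moments of \<open>c\<close>. The right side collects the shares of the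
  zero pair, of the other collinear pairs, and of the pairs that span a line of the cover.\<close>

lemma second_moment_identity:
  fixes q z m A \<Lambda> :: real
  assumes "\<Lambda> * (q\<^sup>2 - 1) = m * (q ^ 4 * z - 1)" and "A * (q\<^sup>2 - 1) = m * (z - 1)" and "q > 1"
  shows "\<Lambda> * (z\<^sup>2 * (\<Lambda> + (q + 1) * (m * (q\<^sup>2 - 1)) + (q\<^sup>2 - 1) * (q\<^sup>2 - q)))
      - 2 * A * (\<Lambda> * (q\<^sup>2 * z)\<^sup>2) + A\<^sup>2 * (q ^ 4 * z)\<^sup>2
    = (\<Lambda> - A)\<^sup>2 + ((q + 1) * (q ^ 4 * z) - q - 1) * (m * z)\<^sup>2
      + \<Lambda> * ((q\<^sup>2 - 1) * (q\<^sup>2 - q)) * z\<^sup>2"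
proof -
  have "(\<Lambda> - A) * (q\<^sup>2 - 1) = m * z * (q\<^sup>2 + 1) * (q\<^sup>2 - 1)"
    using assms(1,2) by (simp add: algebra_simps)
  moreover have "(\<Lambda> - A * q ^ 4) * (q\<^sup>2 - 1) = m * (q\<^sup>2 + 1) * (q\<^sup>2 - 1)"
  proof -
    have "(\<Lambda> - A * q ^ 4) * (q\<^sup>2 - 1) = \<Lambda> * (q\<^sup>2 - 1) - q ^ 4 * (A * (q\<^sup>2 - 1))"
      by (simp add: algebra_simps)
    also have "\<dots> = m * (q ^ 4 - 1)" unfolding assms by (simp add: algebra_simps)
    finally show ?thesis by (simp add: algebra_simps)
  qed
  moreover have "q\<^sup>2 - 1 \<noteq> 0" using assms(3) by (simp add: power2_eq_1_iff)
  ultimately have 1: "\<Lambda> - A = m * z * (q\<^sup>2 + 1)" and 2: "\<Lambda> - A * q ^ 4 = m * (q\<^sup>2 + 1)"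
    by simp_all
  \<comment> \<open>The terms quadratic in \<open>\<Lambda>\<close> and \<open>A\<close> form the
    square of \<open>z * (\<Lambda> - A * q ^ 4)\<close>, so that equation 2 and the first
    assumption eliminate them.\<close>
  have "\<Lambda> * (z\<^sup>2 * (\<Lambda> + (q + 1) * (m * (q\<^sup>2 - 1)) + (q\<^sup>2 - 1) * (q\<^sup>2 - q)))
      - 2 * A * (\<Lambda> * (q\<^sup>2 * z)\<^sup>2) + A\<^sup>2 * (q ^ 4 * z)\<^sup>2
    = z\<^sup>2 * ((\<Lambda> - A * q ^ 4)\<^sup>2 + (q + 1) * m * (\<Lambda> * (q\<^sup>2 - 1)) + \<Lambda> * ((q\<^sup>2 - 1) * (q\<^sup>2 - q)))"
    by algebra
  also have "\<dots> = z\<^sup>2 * ((m * (q\<^sup>2 + 1))\<^sup>2 + (q + 1) * m * (m * (q ^ 4 * z - 1)) + \<Lambda> * ((q\<^sup>2 - 1) * (q\<^sup>2 - q)))"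
    unfolding 2 assms(1) by simp
  also have "\<dots> = (m * z * (q\<^sup>2 + 1))\<^sup>2 + ((q + 1) * (q ^ 4 * z) - q - 1) * (m * z)\<^sup>2
      + \<Lambda> * ((q\<^sup>2 - 1) * (q\<^sup>2 - q)) * z\<^sup>2"
    by algebra
  finally show ?thesis unfolding 1 .
qed

text \<open>The orders \<open>q\<close> of the field and \<open>N\<close> of the vector space are
  real parameters, because the counts involve subtraction and division.\<close>

locale line_cover =
  fixes b :: "'k::{field,finite} ^ 'n::finite \<Rightarrow> 'k ^ 'n \<Rightarrow> 'k"
    and m :: nat and L :: "('k ^ 'n) set set" and q N :: real
  assumes form: "nondegenerate_alternating b" and cover: "m_cover b m L"
    and real_CARD [simp]: "real CARD('k) = q" and N_eq: "N = q ^ CARD('n)"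
begin

lemma real_CARD_power: "real (CARD('k) ^ j) = q ^ j"
  by simp

text \<open>The number of these lines is the quantity \<open>c(u, v)\<close>. It is defined for
  collinear pairs too, so that it can be summed over all pairs of vectors.\<close>

definition perp_lines :: "'k ^ 'n \<Rightarrow> 'k ^ 'n \<Rightarrow> ('k ^ 'n) set set" where
  "perp_lines u v = {k \<in> L. k \<subseteq> perp b {u, v}}"

lemma q_gt_1: "q > 1"
  using card_field_gt_1[where 'k = 'k] by (simp flip: real_CARD)

lemma L_lines: "k \<in> L \<Longrightarrow> k \<in> pg_lines"
  using cover by (auto simp: m_cover_def symplectic_lines_def)

lemma L_isotropic: "k \<in> L \<Longrightarrow> x \<in> k \<Longrightarrow> y \<in> k \<Longrightarrow> b x y = 0"
  using cover by (auto simp: m_cover_def symplectic_lines_def)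

lemma L_subspace: "k \<in> L \<Longrightarrow> vec.subspace k"
  using L_lines by (auto simp: pg_lines_def)

lemma L_card: "k \<in> L \<Longrightarrow> real (card k) = q\<^sup>2"
  using card_pg_line[OF L_lines] by simp

section \<open>Lines of the cover through a vector and in the perp of a point\<close>

lemma card_lines_through:
  assumes "w \<noteq> 0"
  shows "card {k \<in> L. w \<in> k} = m"
proof -
  have "w \<in> k \<longleftrightarrow> vec.span {w} \<subseteq> k" if "k \<in> L" for k
    using vec.span_minimal[of "{w}" k] vec.span_base[of w "{w}"] L_subspace[OF that] by auto
  then have "{k \<in> L. w \<in> k} = {k \<in> L. vec.span {w} \<subseteq> k}" by auto
  then show ?thesis
    using cover span_singleton_in_points[OF assms] by (auto simp: m_cover_def)
qed

text \<open>Double count of the incidences between nonzero vectors of \<open>U\<close> and lines of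
  \<open>L\<close>; each such vector lies on \<open>m\<close> lines. It is applied to the whole
  space, to the perp of a vector and to a line of \<open>L\<close>.\<close>

lemma sum_card_Int:
  assumes "0 \<in> U"
  shows "(\<Sum>k\<in>L. real (card (k \<inter> U)) - 1) = m * (real (card U) - 1)"
proof -
  have "(\<Sum>k\<in>L. real (card (k \<inter> U)) - 1) = (\<Sum>k\<in>L. \<Sum>w\<in>U - {0}. of_bool (w \<in> k))"
  proof (rule sum.cong[OF refl])
    fix k assume "k \<in> L"
    then have "k \<inter> U = insert 0 {w \<in> U - {0}. w \<in> k}"
      using assms vec.subspace_0[OF L_subspace] by auto
    then have "card (k \<inter> U) = Suc (card {w \<in> U - {0}. w \<in> k})" by simp
    then show "real (card (k \<inter> U)) - 1 = (\<Sum>w\<in>U - {0}. of_bool (w \<in> k))"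
      by (simp only: sum_of_bool_card finite)
  qed
  also have "\<dots> = (\<Sum>w\<in>U - {0}. \<Sum>k\<in>L. of_bool (w \<in> k))" by (rule sum.swap)
  also have "\<dots> = (\<Sum>w\<in>U - {0}. real m)"
    by (intro sum.cong refl) (simp add: card_lines_through sum_of_bool_card del: sum_of_bool_eq)
  also have "\<dots> = m * (real (card U) - 1)"
    using assms card_gt_0_iff[of U] by (auto simp: of_nat_diff Suc_le_eq)
  finally show ?thesis .
qed

lemma card_L: "real (card L) * (q\<^sup>2 - 1) = m * (N - 1)"
proof -
  have "(\<Sum>k\<in>L. real (card (k \<inter> UNIV)) - 1) = (\<Sum>k\<in>L. q\<^sup>2 - 1)"
    by (intro sum.cong refl) (simp add: L_card)
  then show ?thesis using sum_card_Int[of UNIV] by (simp add: CARD_vec N_eq)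
qed

lemma card_perp_singleton:
  assumes "w \<noteq> 0"
  shows "real (card (perp b {w})) * q = N"
proof -
  have "vec.dim (vec.span {w}) = 1"
    using span_singleton_in_points[OF assms] by (simp add: pg_points_def)
  then have "real (card (vec.span {w})) = q" by (simp add: card_subspace)
  moreover have "real (card (vec.span {w}) * card (perp b {w})) = N"
    using card_perp[OF form, of "vec.span {w}"] by (simp add: perp_span[OF form] N_eq)
  ultimately show ?thesis by (simp add: mult.commute)
qed

lemma card_perp_line:
  assumes "l \<in> pg_lines"
  shows "real (card (perp b l)) * q\<^sup>2 = N"
proof -
  have "vec.subspace l" using assms by (simp add: pg_lines_def)
  then have "card l * card (perp b l) = CARD('k) ^ CARD('n)" by (rule card_perp[OF form])
  then have "real (card l * card (perp b l)) = N"
    by (simp only: real_CARD_power N_eq)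
  then show ?thesis using card_pg_line[OF assms] by (simp add: mult.commute)
qed

text \<open>The perp of \<open>w\<close> is a hyperplane. A line that it does not contain meets it
  in \<open>q\<close> vectors, so the incidence count \<open>sum_card_Int\<close> for this
  hyperplane determines how many lines of \<open>L\<close> it contains.\<close>

lemma card_lines_in_perp_singleton:
  assumes "w \<noteq> 0"
  shows "real (card {k \<in> L. k \<subseteq> perp b {w}}) * (q\<^sup>2 - q) + card L * (q - 1) = m * (N / q - 1)"
proof -
  have "(\<Sum>k\<in>L. real (card (k \<inter> perp b {w})) - 1)
      = (\<Sum>k\<in>L. (q\<^sup>2 - q) * of_bool (k \<subseteq> perp b {w}) + (q - 1))"
  proof (rule sum.cong[OF refl])
    fix k assume k: "k \<in> L"
    show "real (card (k \<inter> perp b {w})) - 1 = (q\<^sup>2 - q) * of_bool (k \<subseteq> perp b {w}) + (q - 1)"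
    proof (cases "k \<subseteq> perp b {w}")
      case True
      then have "k \<inter> perp b {w} = k" by blast
      then show ?thesis using True L_card[OF k] by simp
    next
      case False
      then obtain a where "a \<in> k" "b w a \<noteq> 0" by (auto simp: perp_def)
      then have "card k = CARD('k) * card {x \<in> k. b w x = 0}"
        by (intro card_kernel[where a = a] L_subspace[OF k])
          (auto simp: form_add_right[OF form] form_scale_right[OF form])
      also have "{x \<in> k. b w x = 0} = k \<inter> perp b {w}" by (auto simp: perp_def)
      finally have "q\<^sup>2 = q * card (k \<inter> perp b {w})" using L_card[OF k] by simp
      then show ?thesis using False q_gt_1 by (simp add: power2_eq_square)
    qed
  qed
  also have "\<dots> = real (card {k \<in> L. k \<subseteq> perp b {w}}) * (q\<^sup>2 - q) + card L * (q - 1)"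
    by (simp add: sum.distrib sum_distrib_left[symmetric] sum_of_bool_card del: sum_of_bool_eq)
  also have "(\<Sum>k\<in>L. real (card (k \<inter> perp b {w})) - 1) = m * (real (card (perp b {w})) - 1)"
    by (rule sum_card_Int[OF vec.subspace_0[OF subspace_perp[OF form]]])
  also have "real (card (perp b {w})) = N / q"
    using card_perp_singleton[OF assms] q_gt_1 by (simp add: field_simps)
  finally show ?thesis by simp
qed

lemma perp_collinear_pair:
  assumes "collinear_pair u v" "u \<noteq> 0 \<or> v \<noteq> 0"
  obtains w where "w \<noteq> 0" "perp b {u, v} = perp b {w}"
proof (cases "u = 0")
  case True
  have "b 0 y = 0" for y using form_scale_left[OF form, of 0 0 y] by simp
  then show ?thesis using True assms that[of v] by (auto simp: perp_def)
next
  case False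
  then obtain t where "v = t *s u" using assms by (auto simp: collinear_pair_def)
  then show ?thesis using False that[of u]
    by (auto simp: perp_def form_scale_left[OF form])
qed

section \<open>First and second moment of the number of cover lines in a perp\<close>

lemma mem_perp_lines_iff: "k \<in> perp_lines u v \<longleftrightarrow> k \<in> L \<and> u \<in> perp b k \<and> v \<in> perp b k"
  unfolding perp_lines_def using subset_perp_iff[OF form, of k "{u, v}"] by auto

text \<open>By symmetry of the perp, a fixed line \<open>k\<close> is counted by exactly the pairs
  in the square of \<open>perp b k\<close>. This form makes the order of summation
  exchangeable.\<close>

lemma card_perp_lines_eq_sum:
  "real (card (perp_lines u v)) = (\<Sum>k\<in>L. of_bool ((u, v) \<in> perp b k \<times> perp b k))"
proof -
  have "perp_lines u v = {k \<in> L. (u, v) \<in> perp b k \<times> perp b k}"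
    by (auto simp: mem_perp_lines_iff)
  then show ?thesis by (simp only: sum_of_bool_card finite)
qed

text \<open>The intersection of the perps is the perp of the subspace sum of \<open>k\<close> and
  \<open>k'\<close>, and that sum has \<open>q ^ 4 / card (k \<inter> k')\<close> vectors.\<close>

lemma card_perp_Int:
  assumes "k \<in> L" "k' \<in> L"
  shows "real (card (perp b k \<inter> perp b k')) * q ^ 4 = N * card (k \<inter> k')"
proof -
  let ?S = "{x + y |x y. x \<in> k \<and> y \<in> k'}"
  have s: "vec.subspace k" "vec.subspace k'" using assms L_subspace by auto
  have "perp b k \<inter> perp b k' = perp b (k \<union> k')" by (auto simp: perp_def)
  also have "\<dots> = perp b (vec.span (k \<union> k'))" by (simp add: perp_span[OF form])
  also have "vec.span (k \<union> k') = ?S"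
    using s by (simp add: vec.span_Un vec.span_eq_iff[THEN iffD2])
  finally have "perp b k \<inter> perp b k' = perp b ?S" .
  moreover have "card ?S * card (perp b ?S) = CARD('k) ^ CARD('n)"
    using card_perp[OF form vec.subspace_sums[OF s]] .
  then have N: "real (card ?S * card (perp b ?S)) = N"
    by (simp only: real_CARD_power N_eq)
  moreover have q4: "real (card ?S) * card (k \<inter> k') = q ^ 4"
  proof -
    have "real (card ?S) * card (k \<inter> k') = real (card k) * real (card k')"
      using card_sum_Int[OF s] by (simp only: of_nat_mult[symmetric])
    then show ?thesis using assms L_card by (simp flip: power_add)
  qed
  ultimately show ?thesis by (simp flip: N q4)
qed

text \<open>The intersection of two lines has \<open>1\<close>, \<open>q\<close> or \<open>q\<^sup>2\<close> vectors.\<close>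

lemma card_Int_lines_squared:
  assumes "k \<in> L" "k' \<in> L"
  shows "(real (card (k \<inter> k')))\<^sup>2
    = 1 + (q + 1) * (real (card (k \<inter> k')) - 1) + (if k = k' then (q\<^sup>2 - 1) * (q\<^sup>2 - q) else 0)"
proof -
  have s: "vec.subspace k" "vec.subspace k'" and d: "vec.dim k = 2" "vec.dim k' = 2"
    using assms L_lines by (auto simp: pg_lines_def)
  have i: "vec.subspace (k \<inter> k')" using s by (rule vec.subspace_inter)
  have c: "real (card (k \<inter> k')) = q ^ vec.dim (k \<inter> k')" using card_subspace[OF i] by simp
  have "vec.dim (k \<inter> k') \<le> 2" using vec.dim_subset[of "k \<inter> k'" k] d by simp
  then consider "vec.dim (k \<inter> k') = 0" | "vec.dim (k \<inter> k') = 1" | "vec.dim (k \<inter> k') = 2"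
    by linarith
  \<comment> \<open>The linear expression \<open>1 + (q + 1) * (x - 1)\<close> interpolates the
    square of \<open>x\<close> at \<open>x = 1\<close> and \<open>x = q\<close>; the last summand
    corrects the value at \<open>x = q\<^sup>2\<close>, which occurs only for equal lines.\<close>
  then show ?thesis
  proof cases
    case 1
    then have "k \<noteq> k'" using d(1) by (auto simp del: vec.dim_eq_0)
    then show ?thesis using c 1 by simp
  next
    case 2
    then have "k \<noteq> k'" using d(1) by auto
    then show ?thesis using c 2 by (simp add: power2_eq_square algebra_simps)
  next
    case 3
    then have "k \<inter> k' = k" "k \<inter> k' = k'"
      using vec.subspace_dim_equal[OF i s(1)] vec.subspace_dim_equal[OF i s(2)] d by auto
    then have "k = k'" by simp
    then show ?thesis using c 3 by (simp add: power2_eq_square algebra_simps)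
  qed
qed

text \<open>The linearized square reduces the sum to the incidence count \<open>sum_card_Int\<close>
  with \<open>U = k\<close>; the correction term contributes once, at \<open>k' = k\<close>.\<close>

lemma sum_card_Int_squared:
  assumes k: "k \<in> L"
  shows "(\<Sum>k'\<in>L. (real (card (k \<inter> k')))\<^sup>2)
    = card L + (q + 1) * (m * (q\<^sup>2 - 1)) + (q\<^sup>2 - 1) * (q\<^sup>2 - q)"
proof -
  have "(\<Sum>k'\<in>L. (real (card (k \<inter> k')))\<^sup>2)
      = (\<Sum>k'\<in>L. 1 + (q + 1) * (real (card (k' \<inter> k)) - 1) + (if k = k' then (q\<^sup>2 - 1) * (q\<^sup>2 - q) else 0))"
    by (intro sum.cong refl) (simp only: card_Int_lines_squared[OF k] Int_commute[of _ k])
  also have "\<dots> = card L + (q + 1) * (\<Sum>k'\<in>L. real (card (k' \<inter> k)) - 1) + (q\<^sup>2 - 1) * (q\<^sup>2 - q)"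
    using k by (simp only: sum.distrib sum_distrib_left[symmetric] sum.delta' finite) simp
  also have "(\<Sum>k'\<in>L. real (card (k' \<inter> k)) - 1) = m * (q\<^sup>2 - 1)"
    using sum_card_Int[of k] vec.subspace_0[OF L_subspace[OF k]] L_card[OF k] by simp
  finally show ?thesis .
qed

lemma sum_card_perp_lines:
  "(\<Sum>p\<in>UNIV. real (card (perp_lines (fst p) (snd p)))) = card L * (N / q\<^sup>2)\<^sup>2"
proof -
  have "(\<Sum>p\<in>UNIV. real (card (perp_lines (fst p) (snd p))))
      = (\<Sum>k\<in>L. \<Sum>p\<in>UNIV. of_bool (p \<in> perp b k \<times> perp b k))"
    by (subst sum.swap) (simp only: card_perp_lines_eq_sum prod.collapse)
  also have "\<dots> = (\<Sum>k\<in>L. (N / q\<^sup>2)\<^sup>2)"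
  proof (rule sum.cong[OF refl])
    fix k assume "k \<in> L"
    then have "real (card (perp b k)) = N / q\<^sup>2"
      using card_perp_line[OF L_lines] q_gt_1 by (simp add: field_simps)
    then show "(\<Sum>p\<in>UNIV. of_bool (p \<in> perp b k \<times> perp b k)) = (N / q\<^sup>2)\<^sup>2"
      by (simp only: sum_of_bool_Times)
  qed
  finally show ?thesis by simp
qed

text \<open>Expanding the square leads to pairs of lines \<open>k\<close>, \<open>k'\<close> and the
  pairs of vectors orthogonal to both. Their number is the square of the size of
  \<open>perp b k \<inter> perp b k'\<close>, hence a multiple of the square of
  \<open>card (k \<inter> k')\<close>.\<close>

lemma sum_card_perp_lines_squared:
  "(\<Sum>p\<in>UNIV. (real (card (perp_lines (fst p) (snd p))))\<^sup>2)
    = card L * ((N / q ^ 4)\<^sup>2 * (card L + (q + 1) * (m * (q\<^sup>2 - 1)) + (q\<^sup>2 - 1) * (q\<^sup>2 - q)))"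
proof -
  let ?f = "\<lambda>p k. of_bool (p \<in> perp b k \<times> perp b k) :: real"
  have "(\<Sum>p\<in>UNIV. (real (card (perp_lines (fst p) (snd p))))\<^sup>2)
      = (\<Sum>p\<in>UNIV. \<Sum>k\<in>L. \<Sum>k'\<in>L. ?f p k * ?f p k')"
    by (simp only: card_perp_lines_eq_sum prod.collapse power2_eq_square sum_product)
  also have "\<dots> = (\<Sum>k\<in>L. \<Sum>p\<in>UNIV. \<Sum>k'\<in>L. ?f p k * ?f p k')" by (rule sum.swap)
  also have "\<dots> = (\<Sum>k\<in>L. \<Sum>k'\<in>L. \<Sum>p\<in>UNIV. ?f p k * ?f p k')"
    by (rule sum.cong[OF refl]) (rule sum.swap)
  also have "\<dots> = (\<Sum>k\<in>L. \<Sum>k'\<in>L. (N / q ^ 4)\<^sup>2 * (real (card (k \<inter> k')))\<^sup>2)"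
  proof (intro sum.cong refl)
    fix k k' assume k: "k \<in> L" "k' \<in> L"
    let ?I = "perp b k \<inter> perp b k'"
    have "(\<Sum>p\<in>UNIV. ?f p k * ?f p k') = (\<Sum>p\<in>UNIV. of_bool (p \<in> ?I \<times> ?I))"
      by (intro sum.cong refl) auto
    also have "\<dots> = (real (card ?I))\<^sup>2"
      by (rule sum_of_bool_Times)
    also have "real (card ?I) = N / q ^ 4 * card (k \<inter> k')"
      using card_perp_Int[OF k] q_gt_1 by (simp add: field_simps)
    finally show "(\<Sum>p\<in>UNIV. ?f p k * ?f p k') = (N / q ^ 4)\<^sup>2 * (real (card (k \<inter> k')))\<^sup>2"
      by (simp only: power_mult_distrib)
  qed
  also have "\<dots> = (\<Sum>k\<in>L. (N / q ^ 4)\<^sup>2 * (card L + (q + 1) * (m * (q\<^sup>2 - 1)) + (q\<^sup>2 - 1) * (q\<^sup>2 - q)))"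
    by (intro sum.cong refl) (simp only: sum_card_Int_squared sum_distrib_left[symmetric])
  finally show ?thesis by simp
qed

section \<open>Collinear pairs, spanning pairs and the variance\<close>

lemma card_perp_lines_collinear:
  assumes "collinear_pair u v" "u \<noteq> 0 \<or> v \<noteq> 0"
  shows "real (card (perp_lines u v)) * (q\<^sup>2 - q) + card L * (q - 1) = m * (N / q - 1)"
proof -
  obtain w where "w \<noteq> 0" "perp b {u, v} = perp b {w}"
    using assms by (rule perp_collinear_pair)
  then show ?thesis
    using card_lines_in_perp_singleton[of w] by (simp add: perp_lines_def)
qed

text \<open>These pairs are the ordered bases of \<open>k\<close>, obtained by removing the
  collinear pairs from \<open>k \<times> k\<close>.\<close>

lemma card_pairs_spanning_line:
  assumes "k \<in> L"
  shows "real (card {p \<in> k \<times> k. \<not> collinear_pair (fst p) (snd p)}) = (q\<^sup>2 - 1) * (q\<^sup>2 - q)"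
proof -
  let ?C = "{(u, v). u \<in> k \<and> v \<in> k \<and> collinear_pair u v}"
  have "{p \<in> k \<times> k. \<not> collinear_pair (fst p) (snd p)} = k \<times> k - ?C" by auto
  moreover have "?C \<subseteq> k \<times> k" by auto
  moreover from this have "card ?C \<le> card (k \<times> k)" by (rule card_mono[rotated]) simp
  ultimately have "card {p \<in> k \<times> k. \<not> collinear_pair (fst p) (snd p)} = card (k \<times> k) - card ?C"
    and "card ?C \<le> card (k \<times> k)"
    by (simp_all only: card_Diff_subset finite)
  then have "real (card {p \<in> k \<times> k. \<not> collinear_pair (fst p) (snd p)}) = q\<^sup>2 * q\<^sup>2 - card ?C"
    using L_card[OF assms] by (simp add: of_nat_diff card_cartesian_product)
  moreover have "real (card ?C + CARD('k)) = real ((CARD('k) + 1) * card k)"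
    by (simp only: card_collinear_pairs[OF L_subspace[OF assms]])
  then have "real (card ?C) = (q + 1) * q\<^sup>2 - q"
    using L_card[OF assms] by (simp add: algebra_simps)
  ultimately show ?thesis by (simp add: algebra_simps power2_eq_square)
qed

lemma card_pairs_spanning:
  "real (card {p. \<not> collinear_pair (fst p) (snd p) \<and> vec.span {fst p, snd p} \<in> L})
    = card L * ((q\<^sup>2 - 1) * (q\<^sup>2 - q))"
proof -
  let ?P = "\<lambda>k. {p \<in> k \<times> k. \<not> collinear_pair (fst p) (snd p)}"
  have "{p. \<not> collinear_pair (fst p) (snd p) \<and> vec.span {fst p, snd p} \<in> L} = (\<Union>k\<in>L. ?P k)"
    using span_pair_eq_line[OF L_lines] by (auto intro: vec.span_base)
  also have "card \<dots> = (\<Sum>k\<in>L. card (?P k))"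
  proof (rule card_UN_disjoint)
    show "\<forall>k\<in>L. \<forall>k'\<in>L. k \<noteq> k' \<longrightarrow> ?P k \<inter> ?P k' = {}"
    proof (intro ballI impI equals0I)
      fix k k' p assume k: "k \<in> L" "k' \<in> L" "k \<noteq> k'" and p: "p \<in> ?P k \<inter> ?P k'"
      from p have "fst p \<in> k" "snd p \<in> k" "fst p \<in> k'" "snd p \<in> k'" "\<not> collinear_pair (fst p) (snd p)"
        by auto
      then have "vec.span {fst p, snd p} = k" "vec.span {fst p, snd p} = k'"
        using span_pair_eq_line[OF L_lines, of _ "fst p" "snd p"] k by blast+
      then show False using k by simp
    qed
  qed auto
  also have "real \<dots> = (\<Sum>k\<in>L. (q\<^sup>2 - 1) * (q\<^sup>2 - q))"
    unfolding of_nat_sum by (intro sum.cong refl card_pairs_spanning_line)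
  finally show ?thesis by simp
qed

lemma card_collinear: "real (card {p. collinear_pair (fst p) (snd p :: 'k ^ 'n)}) = (q + 1) * N - q"
proof -
  have "real (card {(u, v). u \<in> UNIV \<and> v \<in> UNIV \<and> collinear_pair u (v :: 'k ^ 'n)} + CARD('k))
      = real ((CARD('k) + 1) * CARD('k ^ 'n))"
    by (simp only: card_collinear_pairs[OF vec.subspace_UNIV])
  moreover have "{(u, v). u \<in> UNIV \<and> v \<in> UNIV \<and> collinear_pair u (v :: 'k ^ 'n)}
      = {p. collinear_pair (fst p) (snd p)}"
    by auto
  ultimately show ?thesis by (simp add: CARD_vec N_eq algebra_simps)
qed

text \<open>The perp of a nonzero collinear pair is a hyperplane, so the count is the same for every
  cover with parameter \<open>m\<close>. In the application \<open>z\<close> is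
  \<open>q ^ (r - 3)\<close> and \<open>A\<close> is the value prescribed for lines outside
  \<open>L\<close>.\<close>

lemma card_perp_lines_collinear_eq:
  fixes z A :: real
  assumes z: "N = q ^ 4 * z" and A: "A * (q\<^sup>2 - 1) = m * (z - 1)"
    and "collinear_pair u v" "u \<noteq> 0 \<or> v \<noteq> 0"
  shows "card (perp_lines u v) = A + m * z"
proof -
  let ?c = "real (card (perp_lines u v))" and ?l = "real (card L)"
  have c: "?c * (q\<^sup>2 - q) + ?l * (q - 1) = m * (q ^ 3 * z - 1)"
    using card_perp_lines_collinear[OF assms(3,4)] q_gt_1 by (simp add: z power_numeral_reduce)
  have l: "?l * (q\<^sup>2 - 1) = m * (q ^ 4 * z - 1)" using card_L by (simp add: z)
  \<comment> \<open>\<open>A\<close> and \<open>card L\<close> are known only after multiplication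
    by \<open>q\<^sup>2 - 1\<close>, and \<open>?c\<close> only after multiplication by
    \<open>q\<^sup>2 - q\<close>; the product of both factors lets all three relations be
    substituted without division.\<close>
  have "?c * (q * (q - 1) * (q\<^sup>2 - 1)) = (?c * (q\<^sup>2 - q)) * (q\<^sup>2 - 1)"
    by (simp add: algebra_simps power2_eq_square)
  also have "\<dots> = m * (q ^ 3 * z - 1) * (q\<^sup>2 - 1) - (q - 1) * (?l * (q\<^sup>2 - 1))"
    using c by algebra
  also have "\<dots> = (m * (z - 1) + m * z * (q\<^sup>2 - 1)) * (q * (q - 1))"
    unfolding l by algebra
  also have "\<dots> = (A + m * z) * (q * (q - 1) * (q\<^sup>2 - 1))"
    using A by algebra
  finally show ?thesis using q_gt_1 by (auto simp: power2_eq_1_iff)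
qed

text \<open>The first two moments of \<open>(u, v) \<mapsto> card (perp_lines u v)\<close> are determined by the cover, and they
  leave no variance for the pairs that span a line outside \<open>L\<close>.\<close>

lemma card_perp_lines_outside:
  fixes z A :: real
  assumes z: "N = q ^ 4 * z" and A: "A * (q\<^sup>2 - 1) = m * (z - 1)"
    and inside: "\<And>u v. \<not> collinear_pair u v \<Longrightarrow> vec.span {u, v} \<in> L \<Longrightarrow> card (perp_lines u v) = A + z"
    and out: "\<not> collinear_pair u v" "vec.span {u, v} \<notin> L"
  shows "card (perp_lines u v) = A"
proof -
  define c where "c = (\<lambda>p. real (card (perp_lines (fst p) (snd p))))"
  let ?C = "{p. collinear_pair (fst p) (snd p :: 'k ^ 'n)}"
  let ?S = "{p. \<not> collinear_pair (fst p) (snd p) \<and> vec.span {fst p, snd p} \<in> L}"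
  let ?R = "{p. \<not> collinear_pair (fst p) (snd p) \<and> vec.span {fst p, snd p} \<notin> L}"
  have "(\<Sum>p\<in>UNIV. (c p - A)\<^sup>2) = (\<Sum>p\<in>UNIV. (c p)\<^sup>2) - 2 * A * (\<Sum>p\<in>UNIV. c p) + (\<Sum>p\<in>(UNIV :: (('k ^ 'n) \<times> ('k ^ 'n)) set). A\<^sup>2)"
    by (simp only: power2_diff sum.distrib sum_subtractf sum_distrib_left mult.assoc
        mult.commute[of A] mult.left_commute[of A])
  also have "(\<Sum>p\<in>(UNIV :: (('k ^ 'n) \<times> ('k ^ 'n)) set). A\<^sup>2) = A\<^sup>2 * N\<^sup>2"
    by (simp add: CARD_vec N_eq power2_eq_square)
  finally have total: "(\<Sum>p\<in>UNIV. (c p - A)\<^sup>2)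
    = (\<Sum>p\<in>UNIV. (c p)\<^sup>2) - 2 * A * (\<Sum>p\<in>UNIV. c p) + A\<^sup>2 * N\<^sup>2" .
  \<comment> \<open>The pair \<open>(0, 0)\<close> is exceptional among the collinear ones: its perp
    is the whole space and contains every line of \<open>L\<close>.\<close>
  have "(\<Sum>p\<in>?C. (c p - A)\<^sup>2) = (c (0, 0) - A)\<^sup>2 + (\<Sum>p\<in>?C - {(0, 0)}. (c p - A)\<^sup>2)"
    by (rule sum.remove) (auto simp: collinear_pair_def)
  also have "(\<Sum>p\<in>?C - {(0, 0)}. (c p - A)\<^sup>2) = (\<Sum>p\<in>?C - {(0, 0)}. (m * z)\<^sup>2)"
  proof (rule sum.cong[OF refl])
    fix p assume "p \<in> ?C - {(0, 0)}"
    then have "c p = A + m * z"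
      unfolding c_def by (intro card_perp_lines_collinear_eq z A) (auto simp: prod_eq_iff)
    then show "(c p - A)\<^sup>2 = (m * z)\<^sup>2" by simp
  qed
  also have "(\<Sum>p\<in>?C - {(0, 0)}. (m * z)\<^sup>2) = ((q + 1) * N - q - 1) * (m * z)\<^sup>2"
  proof -
    have *: "(0, 0) \<in> ?C" by (auto simp: collinear_pair_def)
    then have "card ?C > 0" by (auto simp only: card_gt_0_iff) auto
    then have "real (card (?C - {(0, 0)})) = real (card ?C) - 1"
      using * by (simp add: of_nat_diff Suc_le_eq)
    then show ?thesis using card_collinear by simp
  qed
  also have "c (0, 0) = card L"
  proof -
    have "b 0 x = 0" for x using form_scale_left[OF form, of 0 0 x] by simp
    then have "perp_lines 0 0 = L" by (auto simp: perp_lines_def perp_def)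
    then show ?thesis by (simp add: c_def)
  qed
  finally have C: "(\<Sum>p\<in>?C. (c p - A)\<^sup>2) = (card L - A)\<^sup>2 + ((q + 1) * N - q - 1) * (m * z)\<^sup>2" .
  have "(\<Sum>p\<in>?S. (c p - A)\<^sup>2) = (\<Sum>p\<in>?S. z\<^sup>2)"
    by (intro sum.cong refl) (auto simp: c_def inside)
  then have S: "(\<Sum>p\<in>?S. (c p - A)\<^sup>2) = card L * ((q\<^sup>2 - 1) * (q\<^sup>2 - q)) * z\<^sup>2"
    using card_pairs_spanning by simp
  have "UNIV = ?C \<union> (?S \<union> ?R)" by auto
  then have "(\<Sum>p\<in>UNIV. (c p - A)\<^sup>2) = (\<Sum>p\<in>?C \<union> (?S \<union> ?R). (c p - A)\<^sup>2)" by metis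
  also have "\<dots> = (\<Sum>p\<in>?C. (c p - A)\<^sup>2) + ((\<Sum>p\<in>?S. (c p - A)\<^sup>2) + (\<Sum>p\<in>?R. (c p - A)\<^sup>2))"
    by (subst sum.union_disjoint; (subst sum.union_disjoint)?) auto
  finally have "(\<Sum>p\<in>?R. (c p - A)\<^sup>2) = (\<Sum>p\<in>UNIV. (c p)\<^sup>2) - 2 * A * (\<Sum>p\<in>UNIV. c p) + A\<^sup>2 * N\<^sup>2
      - ((card L - A)\<^sup>2 + ((q + 1) * N - q - 1) * (m * z)\<^sup>2 + card L * ((q\<^sup>2 - 1) * (q\<^sup>2 - q)) * z\<^sup>2)"
    unfolding total C S by linarith
  also have "(\<Sum>p\<in>UNIV. c p) = card L * (q\<^sup>2 * z)\<^sup>2"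
  proof -
    have "N / q\<^sup>2 = q\<^sup>2 * z" using q_gt_1 by (simp add: z power_numeral_reduce)
    then show ?thesis using sum_card_perp_lines unfolding c_def by simp
  qed
  also have "(\<Sum>p\<in>UNIV. (c p)\<^sup>2)
      = card L * (z\<^sup>2 * (card L + (q + 1) * (m * (q\<^sup>2 - 1)) + (q\<^sup>2 - 1) * (q\<^sup>2 - q)))"
  proof -
    have "N / q ^ 4 = z" using q_gt_1 by (simp add: z)
    then show ?thesis using sum_card_perp_lines_squared unfolding c_def by simp
  qed
  \<comment> \<open>The known shares exhaust the total, so the remaining sum of squares vanishes and
    each of its terms is zero.\<close>
  finally have "(\<Sum>p\<in>?R. (c p - A)\<^sup>2) = 0"
    using second_moment_identity[OF _ A q_gt_1, of "card L"] card_L unfolding z by simp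
  then have "\<forall>p\<in>?R. (c p - A)\<^sup>2 = 0"
    by (subst (asm) sum_nonneg_eq_0_iff) auto
  then have "c (u, v) = A" using out by auto
  then show ?thesis by (simp add: c_def)
qed

end

section \<open>Extension of scalars\<close>

text \<open>Multiplication by a nonzero \<open>x\<close> permutes the nonzero elements and therefore
  preserves their product.\<close>

lemma power_CARD_eq_self: "(x :: 'k::{field,finite}) ^ CARD('k) = x"
proof (cases "x = 0")
  case False
  have "x ^ (CARD('k) - 1) * \<Prod>(UNIV - {0}) = (\<Prod>y\<in>UNIV - {0}. x * y)"
    by (simp add: prod.distrib)
  also have "\<dots> = \<Prod>(UNIV - {0})"
    by (rule prod.reindex_bij_witness[of _ "\<lambda>y. y / x" "\<lambda>y. x * y"]) (use False in auto)
  finally have "x ^ (CARD('k) - 1) = 1" by simp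
  then have "x ^ Suc (CARD('k) - 1) = x" by (simp only: power_Suc mult_1_right)
  moreover have "Suc (CARD('k) - 1) = CARD('k)" using card_field_gt_1[where 'k = 'k] by simp
  ultimately show ?thesis by (simp only:)
qed (use card_field_gt_1[where 'k = 'k] in simp)

lemma extend_form_add_left: "extend_form h b (x + y) z = extend_form h b x z + extend_form h b y z"
  by (simp add: extend_form_def algebra_simps sum.distrib)

lemma extend_form_add_right: "extend_form h b z (x + y) = extend_form h b z x + extend_form h b z y"
  by (simp add: extend_form_def algebra_simps sum.distrib)

lemma extend_form_scale_left: "extend_form h b (c *s x) z = c * extend_form h b x z"
  by (simp add: extend_form_def algebra_simps sum_distrib_left)

lemma extend_form_scale_right: "extend_form h b z (c *s x) = c * extend_form h b z x"
  by (simp add: extend_form_def algebra_simps sum_distrib_left)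

lemma tau_scale: "tau j (c *s x) = c ^ j *s tau j x"
  by (simp add: tau_def vec_eq_iff power_mult_distrib)

text \<open>The Gram matrix expansion of \<open>b\<close> matches the definition of
  \<open>extend_form\<close>, which is used to compare the two forms on rational vectors.\<close>

lemma form_eq_sum:
  assumes "nondegenerate_alternating b"
  shows "b x y = (\<Sum>i\<in>UNIV. \<Sum>j\<in>UNIV. x $ i * b (axis i 1) (axis j 1) * y $ j)"
proof -
  have 0: "b 0 z = 0" "b z 0 = 0" for z
    using form_scale_left[OF assms, of 0 0 z] form_scale_right[OF assms, of z 0 0] by simp_all
  have left: "b (sum f I) z = (\<Sum>i\<in>I. b (f i) z)" for f z and I :: "'c set"
    by (induction I rule: infinite_finite_induct) (simp_all add: 0 form_add_left[OF assms])
  have right: "b z (sum f I) = (\<Sum>i\<in>I. b z (f i))" for f z and I :: "'c set"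
    by (induction I rule: infinite_finite_induct) (simp_all add: 0 form_add_right[OF assms])
  have "b x y = b (\<Sum>i\<in>UNIV. x $ i *s axis i 1) (\<Sum>j\<in>UNIV. y $ j *s axis j 1)"
    by (simp add: basis_expansion)
  also have "\<dots> = (\<Sum>i\<in>UNIV. b (x $ i *s axis i 1) (\<Sum>j\<in>UNIV. y $ j *s axis j 1))"
    by (rule left)
  also have "\<dots> = (\<Sum>i\<in>UNIV. \<Sum>j\<in>UNIV. x $ i * b (axis i 1) (axis j 1) * y $ j)"
    by (simp add: right form_scale_left[OF assms] form_scale_right[OF assms] sum_distrib_left mult_ac)
  finally show ?thesis .
qed

locale cover_extension = line_cover b m L q N
  for b :: "'a::{field,finite} ^ 'n::finite \<Rightarrow> 'a ^ 'n \<Rightarrow> 'a" and m L q N +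
  fixes h :: "'a \<Rightarrow> 'b::{field,finite}" and w :: 'b
  assumes hom: "field_hom h" and card_b: "CARD('b) = CARD('a)\<^sup>2" and w: "w \<notin> range h"
begin

section \<open>The subfield and the power map that fixes it\<close>

lemma h_add: "h (x + y) = h x + h y" and h_mult: "h (x * y) = h x * h y" and h_1: "h 1 = 1"
  using hom by (auto simp: field_hom_def)

lemma h_0: "h 0 = 0"
  using h_add[of 0 0] by (metis add_0 add_cancel_right_right)

lemma h_minus: "h (- x) = - h x"
  using h_add[of x "- x"] by (simp add: h_0 eq_neg_iff_add_eq_0 add.commute)

lemma h_diff: "h (x - y) = h x - h y"
  using h_add[of x "- y"] by (simp add: h_minus)

lemma h_eq_0_iff: "h x = 0 \<longleftrightarrow> x = 0"
  using h_mult[of x "inverse x"] by (cases "x = 0") (auto simp: h_0 h_1)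

lemma h_divide: "h (x / y) = h x / h y"
proof (cases "y = 0")
  case False
  then show ?thesis using h_mult[of "x / y" y] by (simp add: h_eq_0_iff field_simps)
qed (simp add: h_0)

lemma h_power: "h (x ^ j) = h x ^ j"
  by (induction j) (simp_all add: h_1 h_mult)

lemma h_inj: "inj h"
  using h_diff h_eq_0_iff by (metis injI right_minus_eq)

lemma h_power_CARD: "h x ^ CARD('a) = h x"
  by (metis h_power power_CARD_eq_self)

text \<open>\<open>1\<close> and \<open>\<theta>\<close> are independent over the subfield
  \<open>range h\<close>. The element is left general because both \<open>w\<close> and its
  conjugate \<open>w ^ CARD('a)\<close> are needed.\<close>

lemma h_combination_eq_0:
  assumes "\<theta> \<notin> range h" "h s + \<theta> * h t = 0"
  shows "s = 0" "t = 0"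
proof -
  show "t = 0"
  proof (rule ccontr)
    assume "t \<noteq> 0"
    then have "\<theta> = h (- s / t)"
      using assms(2) by (simp add: h_divide h_minus h_eq_0_iff field_simps eq_neg_iff_add_eq_0)
    then show False using assms(1) by blast
  qed
  then show "s = 0" using assms(2) by (simp add: h_0 h_eq_0_iff)
qed

text \<open>Both sides of \<open>x\<^sup>q - x = (\<Prod>a. x - h a)\<close> are monic polynomials of degree \<open>q\<close> with the roots \<open>h a\<close>.
  This yields \<open>(x + h c)\<^sup>q = x\<^sup>q + h c\<close> without any mention of the characteristic.\<close>

lemma power_CARD_diff_eq_prod: "x ^ CARD('a) - x = (\<Prod>a\<in>UNIV. x - h a)"
proof -
  let ?p = "\<Prod>a\<in>UNIV. [:- h a, 1:]" and ?X = "monom 1 (CARD('a)) :: 'b poly"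
  have deg: "degree ?p = CARD('a)"
    by (simp add: degree_prod_sum_eq)
  have "lead_coeff ?p = 1" by (simp add: lead_coeff_prod)
  \<comment> \<open>The leading terms cancel. On \<open>range h\<close> the product vanishes and the
    power map is the identity, so the difference agrees with the polynomial \<open>[:0, 1:]\<close>
    at \<open>CARD('a)\<close> places, more than either degree.\<close>
  then have "degree (?X - ?p) < CARD('a)"
    using deg card_field_gt_1[where 'k = 'a]
    by (intro degree_lessI) (auto simp: coeff_eq_0 le_less)
  moreover have "degree [:0, 1 :: 'b:] < CARD('a)"
    using card_field_gt_1[where 'k = 'a] by simp
  moreover have "poly (?X - ?p) y = poly [:0, 1:] y" if y: "y \<in> range h" for y
  proof -
    obtain a where "y = h a" using y by blast
    then have "(\<Prod>a\<in>UNIV. y - h a) = 0" by auto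
    then show ?thesis using \<open>y = h a\<close> by (simp add: poly_prod poly_monom h_power_CARD)
  qed
  moreover have "card (range h) = CARD('a)" using h_inj by (rule card_image)
  ultimately have "?X - ?p = [:0, 1:]"
    by (intro poly_eqI_degree[of "range h"]) auto
  then have "poly (?X - ?p) x = poly [:0, 1:] x" by simp
  then show ?thesis by (simp add: poly_prod poly_monom algebra_simps)
qed

lemma power_CARD_add: "(x + h c) ^ CARD('a) = x ^ CARD('a) + h c"
proof -
  have "(x + h c) ^ CARD('a) - (x + h c) = (\<Prod>a\<in>UNIV. x + h c - h a)"
    by (rule power_CARD_diff_eq_prod)
  also have "\<dots> = (\<Prod>a\<in>UNIV. x - h a)"
    by (rule prod.reindex_bij_witness[of _ "\<lambda>a. a + c" "\<lambda>a. a - c"]) (auto simp: h_diff)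
  also have "\<dots> = x ^ CARD('a) - x"
    by (rule power_CARD_diff_eq_prod[symmetric])
  finally show ?thesis by (simp add: algebra_simps)
qed

text \<open>Applying the power map twice is the identity on \<open>'b\<close>, and the map fixes
  \<open>range h\<close>; an image in the subfield would put \<open>w\<close> itself there.\<close>

lemma w_power_notin: "w ^ CARD('a) \<notin> range h"
proof
  assume "w ^ CARD('a) \<in> range h"
  then obtain a where a: "w ^ CARD('a) = h a" by blast
  have "w = (w ^ CARD('a)) ^ CARD('a)"
    using power_CARD_eq_self[of w] by (simp add: card_b power2_eq_square power_mult)
  then show False using w a by (metis h_power_CARD rangeI)
qed

section \<open>Vectors over the large field as pairs of rational vectors\<close>

abbreviation E :: "'a ^ 'n \<Rightarrow> 'b ^ 'n" where "E \<equiv> extend_vec h"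
abbreviation B :: "'b ^ 'n \<Rightarrow> 'b ^ 'n \<Rightarrow> 'b" where "B \<equiv> extend_form h b"

definition comb :: "'a ^ 'n \<Rightarrow> 'a ^ 'n \<Rightarrow> 'b ^ 'n" where
  "comb u v = E u + w *s E v"

lemma E_add: "E (x + y) = E x + E y" and E_scale: "E (c *s x) = h c *s E x" and E_0: "E 0 = 0"
  by (simp_all add: extend_vec_def vec_eq_iff h_add h_mult h_0)

lemma E_combination_eq_0:
  assumes "\<theta> \<notin> range h" "E u + \<theta> *s E v = 0"
  shows "u = 0" "v = 0"
proof -
  have *: "h (u $ i) + \<theta> * h (v $ i) = 0" for i
    using assms(2) by (simp add: extend_vec_def vec_eq_iff)
  show "u = 0" "v = 0"
    using h_combination_eq_0[OF assms(1) *] by (simp_all add: vec_eq_iff)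
qed

lemma E_diff: "E (x - y) = E x - E y"
  by (simp add: extend_vec_def vec_eq_iff h_diff)

lemma comb_eq_iff: "comb u v = comb u' v' \<longleftrightarrow> u = u' \<and> v = v'"
proof
  assume "comb u v = comb u' v'"
  then have "E (u - u') + w *s E (v - v') = 0"
    unfolding E_diff by (simp add: comb_def vec.scale_right_diff_distrib algebra_simps)
  then have "u - u' = 0" "v - v' = 0" by (rule E_combination_eq_0[OF w])+
  then show "u = u' \<and> v = v'" by simp
qed simp

lemma comb_0: "comb 0 0 = 0"
  by (simp add: comb_def E_0)

lemma comb_eq_0_iff: "comb u v = 0 \<longleftrightarrow> u = 0 \<and> v = 0"
  using comb_eq_iff[of u v 0 0] by (simp add: comb_0)

lemma inj_comb: "inj_on (case_prod comb) S"
  by (rule inj_onI) (auto simp: comb_eq_iff)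

text \<open>Surjectivity follows by counting: \<open>comb\<close> is injective, and
  \<open>CARD('b) = CARD('a)\<^sup>2\<close> gives as many pairs as vectors.\<close>

lemma comb_surj: obtains u v where "x = comb u v"
proof -
  have "card (range (case_prod comb)) = CARD(('a ^ 'n) \<times> ('a ^ 'n))"
    by (rule card_image[OF inj_comb])
  also have "\<dots> = CARD('b ^ 'n)"
    by (simp add: CARD_vec card_b power2_eq_square power_mult_distrib)
  finally have "range (case_prod comb) = UNIV" by (intro card_subset_eq) auto
  then show ?thesis using that by (metis (mono_tags) UNIV_I image_iff case_prod_beta)
qed

lemma h_pair_surj: obtains s t where "c = h s + w * h t"
proof -
  \<comment> \<open>A scalar is decomposed through a constant vector, read off at an arbitrary
    index.\<close>
  obtain u v where "(\<chi> i. c) = comb u v" by (rule comb_surj)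
  then have "c = h (u $ undefined) + w * h (v $ undefined)"
    by (simp add: comb_def extend_vec_def vec_eq_iff)
  then show ?thesis by (rule that)
qed

lemma B_E: "B (E x) (E y) = h (b x y)"
proof -
  have h_sum: "h (sum f I) = (\<Sum>i\<in>I. h (f i))" for f and I :: "'n set"
    by (induction I rule: infinite_finite_induct) (simp_all add: h_0 h_add)
  show ?thesis
    by (subst form_eq_sum[OF form]) (simp add: extend_form_def extend_vec_def h_sum h_mult)
qed

text \<open>Conjugation fixes the rational parts \<open>u\<close> and \<open>v\<close> and replaces
  \<open>w\<close> by its conjugate.\<close>

lemma tau_comb: "tau CARD('a) (comb u v) = E u + w ^ CARD('a) *s E v"
proof -
  have "(h s + w * h t) ^ CARD('a) = h s + w ^ CARD('a) * h t" for s t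
    using power_CARD_add[of "w * h t" s]
    by (simp add: add.commute power_mult_distrib h_power_CARD)
  then show ?thesis by (simp add: tau_def comb_def extend_vec_def vec_eq_iff)
qed

text \<open>The value is \<open>h (b x u) + w ^ CARD('a) * h (b x v)\<close>. Since the conjugate of
  \<open>w\<close> lies outside the subfield, it vanishes only if both parts do. Thus unitary
  orthogonality of a rational vector becomes symplectic orthogonality to \<open>u\<close> and
  \<open>v\<close>.\<close>

lemma form_tau_E_eq_0_iff:
  "B (E x) (tau CARD('a) (comb u v)) = 0 \<longleftrightarrow> x \<in> perp b {u, v}"
proof -
  have *: "B (E x) (tau CARD('a) (comb u v)) = h (b x u) + w ^ CARD('a) * h (b x v)"
    by (simp add: tau_comb extend_form_add_right extend_form_scale_right B_E)
  show ?thesis unfolding * perp_eq[OF form]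
    using h_combination_eq_0[OF w_power_notin] by (auto simp: h_0)
qed

lemma extended_line_eq:
  assumes k: "vec.subspace k"
  shows "extended_line h k = case_prod comb ` (k \<times> k)"
proof
  have "vec.subspace (case_prod comb ` (k \<times> k))"
  proof (rule vec.subspaceI)
    show "0 \<in> case_prod comb ` (k \<times> k)"
      using vec.subspace_0[OF k] comb_0 by (intro image_eqI[of _ _ "(0, 0)"]) auto
  next
    fix x y assume "x \<in> case_prod comb ` (k \<times> k)" "y \<in> case_prod comb ` (k \<times> k)"
    then obtain u v u' v' where "u \<in> k" "v \<in> k" "u' \<in> k" "v' \<in> k" "x = comb u v" "y = comb u' v'"
      by auto
    then show "x + y \<in> case_prod comb ` (k \<times> k)"
      by (intro image_eqI[of _ _ "(u + u', v + v')"])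
        (auto simp: comb_def E_add vec.scale_right_distrib intro: vec.subspace_add[OF k])
  next
    fix c x assume "x \<in> case_prod comb ` (k \<times> k)"
    then obtain u v where uv: "u \<in> k" "v \<in> k" "x = comb u v" by auto
    obtain s t where c: "c = h s + w * h t" by (rule h_pair_surj)
    \<comment> \<open>Closure under scalars needs the square of \<open>w\<close> in the basis
      \<open>1\<close>, \<open>w\<close>.\<close>
    obtain s' t' where w2: "w * w = h s' + w * h t'" by (rule h_pair_surj)
    have "c *s x = (h s *s E u + h t *s ((w * w) *s E v)) + w *s (h t *s E u + h s *s E v)"
      by (simp add: uv c comb_def vec_eq_iff algebra_simps)
    also have "\<dots> = comb (s *s u + (t * s') *s v) (t *s u + s *s v + (t * t') *s v)"
      unfolding w2 by (simp add: comb_def E_add E_scale h_mult vec_eq_iff algebra_simps)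
    finally show "c *s x \<in> case_prod comb ` (k \<times> k)"
      using uv by (intro image_eqI[of _ _ "(s *s u + (t * s') *s v, t *s u + s *s v + (t * t') *s v)"])
        (auto intro!: vec.subspace_add[OF k] vec.subspace_scale[OF k])
  qed
  moreover have "E ` k \<subseteq> case_prod comb ` (k \<times> k)"
    using vec.subspace_0[OF k] by (auto simp: comb_def E_0 intro!: image_eqI[of _ _ "(_, 0)"])
  ultimately show "extended_line h k \<subseteq> case_prod comb ` (k \<times> k)"
    unfolding extended_line_def by (intro vec.span_minimal)
  show "case_prod comb ` (k \<times> k) \<subseteq> extended_line h k"
    unfolding extended_line_def
    by (auto simp: comb_def vec.span_base intro!: vec.span_add vec.span_scale)
qed

lemma comb_in_extended_line:
  "k \<in> L \<Longrightarrow> comb u v \<in> extended_line h k \<longleftrightarrow> u \<in> k \<and> v \<in> k"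
  by (auto simp: extended_line_eq[OF L_subspace] comb_eq_iff)

lemma extended_line_isotropic:
  assumes "k \<in> L" "y \<in> extended_line h k"
  shows "B y (tau CARD('a) y) = 0"
proof -
  obtain u v where "y = comb u v" by (rule comb_surj)
  then show ?thesis using assms L_isotropic[OF assms(1)]
    by (simp add: comb_in_extended_line tau_comb)
      (simp add: comb_def extend_form_add_left extend_form_add_right extend_form_scale_left
        extend_form_scale_right B_E h_0)
qed

subsection \<open>Points of the cover in a unitary perp\<close>

lemma unitary_perp_span:
  "unitary_perp CARD('a) h b (vec.span {x}) = {y. B y (tau CARD('a) x) = 0}"
  by (auto simp: unitary_perp_def vec.span_singleton tau_scale extend_form_scale_right dest: spec[of _ 1])

lemma subspace_unitary_perp: "vec.subspace {y. B y (tau CARD('a) x) = 0}"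
proof -
  have "B 0 z = 0" for z using extend_form_scale_left[of h b 0 0 z] by simp
  then show ?thesis
    by (auto simp: vec.subspace_def extend_form_add_left extend_form_scale_left)
qed

lemma span_in_cover_points_iff:
  assumes "y \<noteq> 0"
  shows "vec.span {y} \<in> cover_points CARD('a) h b L \<longleftrightarrow> (\<exists>k\<in>L. y \<in> extended_line h k)"
proof
  assume "vec.span {y} \<in> cover_points CARD('a) h b L"
  then show "\<exists>k\<in>L. y \<in> extended_line h k"
    using vec.span_base[of y "{y}"] by (auto simp: cover_points_def)
next
  assume "\<exists>k\<in>L. y \<in> extended_line h k"
  then obtain k where k: "k \<in> L" "y \<in> extended_line h k" by blast
  then have "vec.span {y} \<subseteq> extended_line h k"
    unfolding extended_line_def by (intro vec.span_minimal) auto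
  then show "vec.span {y} \<in> cover_points CARD('a) h b L"
    using k extended_line_isotropic[OF k(1)] span_singleton_in_points[OF assms]
    by (auto simp: cover_points_def hermitian_variety_def)
qed

text \<open>Each point has \<open>CARD('b) - 1\<close> nonzero vectors, and each vector is replaced
  by its pair of rational parts, so that the remaining counts concern only pairs over the small
  field.\<close>

lemma card_cover_points_perp_vectors:
  "card {Q \<in> cover_points CARD('a) h b L. Q \<subseteq> unitary_perp CARD('a) h b (vec.span {x})} * (CARD('b) - 1)
    = card {p. p \<noteq> (0, 0) \<and> B (case_prod comb p) (tau CARD('a) x) = 0 \<and> (\<exists>k\<in>L. p \<in> k \<times> k)}"
    (is "card ?X * _ = card ?P")
proof -
  have X: "?X \<subseteq> pg_points" by (auto simp: cover_points_def hermitian_variety_def)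
  have "\<Union>?X - {0} = {y. y \<noteq> 0 \<and> B y (tau CARD('a) x) = 0 \<and> (\<exists>k\<in>L. y \<in> extended_line h k)}"
    (is "_ = ?Y")
  proof
    show "\<Union>?X - {0} \<subseteq> ?Y"
      unfolding unitary_perp_span by (auto simp: cover_points_def)
    show "?Y \<subseteq> \<Union>?X - {0}"
    proof
      fix y assume y: "y \<in> ?Y"
      then have "vec.span {y} \<in> cover_points CARD('a) h b L"
        by (simp add: span_in_cover_points_iff)
      moreover have "vec.span {y} \<subseteq> {y. B y (tau CARD('a) x) = 0}"
        using y by (intro vec.span_minimal subspace_unitary_perp) auto
      ultimately have "vec.span {y} \<in> ?X" unfolding unitary_perp_span by simp
      then show "y \<in> \<Union>?X - {0}" using y vec.span_base[of y "{y}"] by blast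
    qed
  qed
  also have "?Y = case_prod comb ` ?P"
  proof (intro set_eqI iffI)
    fix y assume y: "y \<in> ?Y"
    obtain u v where "y = comb u v" by (rule comb_surj)
    then show "y \<in> case_prod comb ` ?P"
      using y by (intro image_eqI[of _ _ "(u, v)"]) (auto simp: comb_in_extended_line comb_0)
  qed (auto simp: comb_in_extended_line comb_eq_0_iff)
  finally have "card (\<Union>?X - {0}) = card ?P" by (simp only: card_image[OF inj_comb])
  then show ?thesis using card_Union_points[OF X] by simp
qed

lemma m_pos: "m > 0"
  using cover by (simp add: m_cover_def)

lemma card_lines_through_collinear:
  assumes "collinear_pair u v" "u \<noteq> 0 \<or> v \<noteq> 0"
  shows "card {k \<in> L. u \<in> k \<and> v \<in> k} = m"
proof -
  define x where "x = (if u = 0 then v else u)"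
  have x: "x \<noteq> 0" using assms by (auto simp: x_def)
  have "u \<in> k \<and> v \<in> k \<longleftrightarrow> x \<in> k" if "k \<in> L" for k
    using assms vec.subspace_0[OF L_subspace[OF that]] vec.subspace_scale[OF L_subspace[OF that]]
    by (auto simp: x_def collinear_pair_def)
  then have "{k \<in> L. u \<in> k \<and> v \<in> k} = {k \<in> L. x \<in> k}" by auto
  then show ?thesis using card_lines_through[OF x] by simp
qed

text \<open>A nonzero collinear pair is on \<open>m > 0\<close> lines of \<open>L\<close>; a
  noncollinear pair can only lie on the line that it spans.\<close>

lemma ex_line_through_pair_iff:
  assumes "u \<noteq> 0 \<or> v \<noteq> 0"
  shows "(\<exists>k\<in>L. u \<in> k \<and> v \<in> k) \<longleftrightarrow> collinear_pair u v \<or> vec.span {u, v} \<in> L"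
proof (cases "collinear_pair u v")
  case True
  then have "card {k \<in> L. u \<in> k \<and> v \<in> k} \<noteq> 0"
    using card_lines_through_collinear[OF True assms] m_pos by simp
  then have "{k \<in> L. u \<in> k \<and> v \<in> k} \<noteq> {}" by (metis card.empty)
  then show ?thesis using True by blast
next
  case False
  then show ?thesis
    using span_pair_eq_line[OF L_lines _ _ False] vec.span_base[of _ "{u, v}"] by blast
qed

lemma card_lines_through_pair:
  assumes "u \<noteq> 0 \<or> v \<noteq> 0"
  shows "real (card {k \<in> L. u \<in> k \<and> v \<in> k})
    = of_bool (\<exists>k\<in>L. u \<in> k \<and> v \<in> k) + (real m - 1) * of_bool (collinear_pair u v)"
proof (cases "collinear_pair u v")
  case True
  then show ?thesis
    using card_lines_through_collinear[OF True assms] ex_line_through_pair_iff[OF assms]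
    by (simp only: of_bool_eq simp_thms) simp
next
  case False
  have "u \<in> k \<and> v \<in> k \<longleftrightarrow> k = vec.span {u, v}" if "k \<in> L" for k
    using span_pair_eq_line[OF L_lines[OF that] _ _ False] vec.span_base[of _ "{u, v}"] by blast
  then have "{k \<in> L. u \<in> k \<and> v \<in> k} = (if vec.span {u, v} \<in> L then {vec.span {u, v}} else {})"
    by (auto split: if_split)
  then have "card {k \<in> L. u \<in> k \<and> v \<in> k} = of_bool (vec.span {u, v} \<in> L)"
    by simp
  then show ?thesis unfolding ex_line_through_pair_iff[OF assms] using False by simp
qed

text \<open>A collinear pair is a scalar multiple of a rational vector under \<open>comb\<close>, so
  its unitary orthogonality reduces to \<open>perp b {u, v}\<close>. The result is the number of
  nonzero collinear pairs in that subspace.\<close>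

lemma card_collinear_perp:
  "real (card {p. p \<noteq> (0, 0) \<and> B (case_prod comb p) (tau CARD('a) (comb u v)) = 0 \<and> collinear_pair (fst p) (snd p)})
    = (q + 1) * (real (card (perp b {u, v})) - 1)"
proof -
  let ?U = "perp b {u, v}"
  let ?C = "{(x, y). x \<in> ?U \<and> y \<in> ?U \<and> collinear_pair x y}"
  have U: "vec.subspace ?U" by (rule subspace_perp[OF form])
  have "B (comb x y) (tau CARD('a) (comb u v)) = 0 \<longleftrightarrow> x \<in> ?U \<and> y \<in> ?U" if c: "collinear_pair x y" for x y
  proof (cases "x = 0")
    case True
    have "w \<noteq> 0" using w h_0 by (metis rangeI)
    moreover have "comb x y = w *s E y" using True by (simp add: comb_def E_0)
    ultimately show ?thesis using True vec.subspace_0[OF U]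
      by (simp add: extend_form_scale_left form_tau_E_eq_0_iff)
  next
    case False
    then obtain t where t: "y = t *s x" using c by (auto simp: collinear_pair_def)
    have "1 + w * h t \<noteq> 0" using h_combination_eq_0(1)[OF w, of 1 t] by (auto simp: h_1)
    moreover have "comb x y = (1 + w * h t) *s E x"
      by (simp add: comb_def t E_scale vec.scale_left_distrib)
    ultimately have "B (comb x y) (tau CARD('a) (comb u v)) = 0 \<longleftrightarrow> x \<in> ?U"
      by (simp only: extend_form_scale_left mult_eq_0_iff form_tau_E_eq_0_iff simp_thms)
    then show ?thesis using t vec.subspace_scale[OF U, of x t] by auto
  qed
  then have "{p. p \<noteq> (0, 0) \<and> B (case_prod comb p) (tau CARD('a) (comb u v)) = 0 \<and> collinear_pair (fst p) (snd p)}
      = ?C - {(0, 0)}"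
    by (auto simp del: vec.scale_eq_0_iff)
  moreover have "(0, 0) \<in> ?C" using vec.subspace_0[OF U] by (auto simp: collinear_pair_def)
  moreover from this have "card ?C > 0" by (auto simp only: card_gt_0_iff finite)
  moreover have "real (card ?C + CARD('a)) = real ((CARD('a) + 1) * card ?U)"
    by (simp only: card_collinear_pairs[OF U])
  ultimately show ?thesis by (simp add: of_nat_diff Suc_le_eq algebra_simps)
qed

text \<open>If \<open>k\<close> lies in \<open>perp b {u, v}\<close>, both parts of every vector are
  orthogonal. Otherwise some rational vector of \<open>k\<close> is not, and the kernel of the
  resulting functional has index \<open>q\<^sup>2\<close> in the \<open>q ^ 4\<close> vectors of the
  extended line. The zero vector is left out in either case.\<close>

lemma card_extended_line_perp:
  assumes k: "k \<in> L"
  shows "real (card {p \<in> k \<times> k. p \<noteq> (0, 0) \<and> B (case_prod comb p) (tau CARD('a) (comb u v)) = 0})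
    = q\<^sup>2 - 1 + (q ^ 4 - q\<^sup>2) * of_bool (k \<in> perp_lines u v)"
proof -
  let ?x = "tau CARD('a) (comb u v)"
  let ?K = "{p \<in> k \<times> k. B (case_prod comb p) ?x = 0}"
  have s: "vec.subspace (extended_line h k)" by (simp add: extended_line_def)
  have "B 0 ?x = 0" using extend_form_scale_left[of h b 0 0 ?x] by simp
  then have 0: "(0, 0) \<in> ?K" using vec.subspace_0[OF L_subspace[OF k]] by (simp add: comb_0)
  have "real (card ?K) = q\<^sup>2 + (q ^ 4 - q\<^sup>2) * of_bool (k \<in> perp_lines u v)"
  proof (cases "k \<in> perp_lines u v")
    case True
    then have "k \<subseteq> perp b {u, v}" by (simp add: perp_lines_def)
    then have "B (comb x y) ?x = 0" if "x \<in> k" "y \<in> k" for x y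
      using that form_tau_E_eq_0_iff[of x u v] form_tau_E_eq_0_iff[of y u v]
      by (auto simp: comb_def[of x y] extend_form_add_left extend_form_scale_left)
    then have "?K = k \<times> k" by auto
    then show ?thesis using True L_card[OF k] by (simp add: card_cartesian_product flip: power_add)
  next
    case False
    then obtain x where x: "x \<in> k" "x \<notin> perp b {u, v}" using k by (auto simp: perp_lines_def)
    then have "E x \<in> extended_line h k" "B (E x) ?x \<noteq> 0"
      by (auto simp: extended_line_def vec.span_base form_tau_E_eq_0_iff)
    then have "card (extended_line h k) = CARD('b) * card {y \<in> extended_line h k. B y ?x = 0}"
      by (intro card_kernel[OF s]) (auto simp: extend_form_add_left extend_form_scale_left)
    also have "{y \<in> extended_line h k. B y ?x = 0} = case_prod comb ` ?K"
      unfolding extended_line_eq[OF L_subspace[OF k]] by auto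
    also have "card (case_prod comb ` ?K) = card ?K" by (rule card_image[OF inj_comb])
    also have "card (extended_line h k) = card (k \<times> k)"
      unfolding extended_line_eq[OF L_subspace[OF k]] by (rule card_image[OF inj_comb])
    finally have "real (card (k \<times> k)) = real (CARD('b) * card ?K)" by (rule arg_cong)
    then have "q\<^sup>2 * q\<^sup>2 = q\<^sup>2 * card ?K"
      using L_card[OF k] by (simp add: card_cartesian_product card_b)
    then have "q\<^sup>2 * (q\<^sup>2 - card ?K) = 0" by (simp only: right_diff_distrib diff_self)
    then have "real (card ?K) = q\<^sup>2" using q_gt_1 by simp
    then show ?thesis using False by simp
  qed
  moreover have "{p \<in> k \<times> k. p \<noteq> (0, 0) \<and> B (case_prod comb p) ?x = 0} = ?K - {(0, 0)}"
    by auto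
  moreover have "?K \<noteq> {}" using 0 by blast
  then have "card ?K > 0" by (simp only: card_gt_0_iff finite simp_thms)
  ultimately show ?thesis using 0 by (simp add: of_nat_diff Suc_le_eq)
qed

text \<open>Double count the incident pairs of a point in the perp of \<open>P\<close> and an extended line of \<open>L\<close>: a point of
  the Baer subgeometry lies on \<open>m\<close> of these lines, every other point of the cover on exactly one.\<close>

lemma card_cover_points_perp:
  "real (card {Q \<in> cover_points CARD('a) h b L. Q \<subseteq> unitary_perp CARD('a) h b (vec.span {comb u v})}) * (q\<^sup>2 - 1)
      + (real m - 1) * ((q + 1) * (real (card (perp b {u, v})) - 1))
    = (q\<^sup>2 - 1) * (card L + q\<^sup>2 * card (perp_lines u v))"
    (is "real (card ?X) * _ + _ = _")
proof -
  let ?Z = "{p. p \<noteq> (0, 0) \<and> B (case_prod comb p) (tau CARD('a) (comb u v)) = 0}"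
  have "real (card ?X) * (q\<^sup>2 - 1) = real (card ?X * (CARD('b) - 1))"
    using card_field_gt_1[where 'k = 'b] card_b by (simp add: of_nat_diff)
  also have "\<dots> = real (card {p \<in> ?Z. \<exists>k\<in>L. p \<in> k \<times> k})"
    unfolding card_cover_points_perp_vectors by (simp add: conj_assoc)
  finally have X: "real (card ?X) * (q\<^sup>2 - 1) = real (card {p \<in> ?Z. \<exists>k\<in>L. p \<in> k \<times> k})" .
  have C: "real (card {p \<in> ?Z. collinear_pair (fst p) (snd p)}) = (q + 1) * (real (card (perp b {u, v})) - 1)"
    using card_collinear_perp[of u v] by (simp add: conj_assoc)
  have "real (card {p \<in> ?Z. \<exists>k\<in>L. p \<in> k \<times> k}) + (real m - 1) * real (card {p \<in> ?Z. collinear_pair (fst p) (snd p)})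
      = (\<Sum>p\<in>?Z. of_bool (\<exists>k\<in>L. p \<in> k \<times> k) + (real m - 1) * of_bool (collinear_pair (fst p) (snd p)))"
    by (simp only: sum.distrib sum_distrib_left[symmetric] sum_of_bool_card finite of_nat_add of_nat_mult)
  also have "\<dots> = (\<Sum>p\<in>?Z. real (card {k \<in> L. p \<in> k \<times> k}))"
  proof (rule sum.cong[OF refl])
    fix p assume "p \<in> ?Z"
    then have "p \<noteq> (0, 0)" by blast
    then have "fst p \<noteq> 0 \<or> snd p \<noteq> 0" by (cases p) simp
    from card_lines_through_pair[OF this]
    show "of_bool (\<exists>k\<in>L. p \<in> k \<times> k) + (real m - 1) * of_bool (collinear_pair (fst p) (snd p))
      = real (card {k \<in> L. p \<in> k \<times> k})"
      by (simp only: mem_Times_iff)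
  qed
  also have "\<dots> = (\<Sum>p\<in>?Z. \<Sum>k\<in>L. of_bool (p \<in> k \<times> k))"
    by (simp only: sum_of_bool_card finite)
  also have "\<dots> = (\<Sum>k\<in>L. \<Sum>p\<in>?Z. of_bool (p \<in> k \<times> k))" by (rule sum.swap)
  also have "\<dots> = (\<Sum>k\<in>L. q\<^sup>2 - 1 + (q ^ 4 - q\<^sup>2) * of_bool (k \<in> perp_lines u v))"
  proof (rule sum.cong[OF refl])
    fix k assume k: "k \<in> L"
    have "(\<Sum>p\<in>?Z. of_bool (p \<in> k \<times> k)) = real (card {p \<in> ?Z. p \<in> k \<times> k})"
      by (simp only: sum_of_bool_card finite)
    also have "{p \<in> ?Z. p \<in> k \<times> k}
        = {p \<in> k \<times> k. p \<noteq> (0, 0) \<and> B (case_prod comb p) (tau CARD('a) (comb u v)) = 0}"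
      by blast
    finally show "(\<Sum>p\<in>?Z. of_bool (p \<in> k \<times> k)) = q\<^sup>2 - 1 + (q ^ 4 - q\<^sup>2) * of_bool (k \<in> perp_lines u v)"
      by (simp only: card_extended_line_perp[OF k])
  qed
  also have "\<dots> = card L * (q\<^sup>2 - 1) + (q ^ 4 - q\<^sup>2) * real (card {k \<in> L. k \<in> perp_lines u v})"
    by (simp only: sum.distrib sum_distrib_left[symmetric] sum_of_bool_card finite) simp
  also have "{k \<in> L. k \<in> perp_lines u v} = perp_lines u v" by (auto simp: perp_lines_def)
  also have "card L * (q\<^sup>2 - 1) + (q ^ 4 - q\<^sup>2) * real (card (perp_lines u v))
      = (q\<^sup>2 - 1) * (card L + q\<^sup>2 * card (perp_lines u v))"
    by (simp add: algebra_simps flip: power_add)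
  finally show ?thesis unfolding X C .
qed

section \<open>The tightness condition at a point and the equivalence\<close>

text \<open>For a rational point both the perp and the number of cover lines in it are determined by
  the parameters. The value is the one that tightness demands of a member, with \<open>T\<close>
  standing for \<open>theta ((int r - 3) div 2) (q\<^sup>2)\<close>.\<close>

lemma card_cover_points_perp_collinear:
  fixes z A T :: real
  assumes z: "N = q ^ 4 * z" and A: "A * (q\<^sup>2 - 1) = m * (z - 1)" and T: "T * (q\<^sup>2 - 1) = q\<^sup>2 * z - 1"
    and uv: "collinear_pair u v" "u \<noteq> 0 \<or> v \<noteq> 0"
  shows "card {Q \<in> cover_points CARD('a) h b L. Q \<subseteq> unitary_perp CARD('a) h b (vec.span {comb u v})}
    = (m * (q\<^sup>2 - q) + q + 1) * T + q\<^sup>2 * z"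
proof -
  let ?n = "real (card {Q \<in> cover_points CARD('a) h b L. Q \<subseteq> unitary_perp CARD('a) h b (vec.span {comb u v})})"
  obtain x where "x \<noteq> 0" "perp b {u, v} = perp b {x}" using uv by (rule perp_collinear_pair)
  then have "real (card (perp b {u, v})) = q ^ 3 * z"
    using card_perp_singleton[of x] q_gt_1 by (simp add: z power_numeral_reduce)
  moreover have "real (card (perp_lines u v)) = A + m * z"
    by (rule card_perp_lines_collinear_eq[OF z A uv])
  ultimately have "?n * (q\<^sup>2 - 1) = (q\<^sup>2 - 1) * (card L + q\<^sup>2 * (A + m * z)) - (real m - 1) * ((q + 1) * (q ^ 3 * z - 1))"
    using card_cover_points_perp[of u v] by simp
  also have "\<dots> = card L * (q\<^sup>2 - 1) + q\<^sup>2 * (A * (q\<^sup>2 - 1) + m * z * (q\<^sup>2 - 1)) - (real m - 1) * ((q + 1) * (q ^ 3 * z - 1))"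
    by algebra
  also have "\<dots> = m * (q ^ 4 * z - 1) + q\<^sup>2 * (m * (z - 1) + m * z * (q\<^sup>2 - 1)) - (real m - 1) * ((q + 1) * (q ^ 3 * z - 1))"
    using card_L by (simp add: A z)
  also have "\<dots> = (m * (q\<^sup>2 - q) + q + 1) * (T * (q\<^sup>2 - 1)) + q\<^sup>2 * z * (q\<^sup>2 - 1)"
    unfolding T by algebra
  finally have "?n * (q\<^sup>2 - 1) = ((m * (q\<^sup>2 - q) + q + 1) * T + q\<^sup>2 * z) * (q\<^sup>2 - 1)"
    by (simp add: algebra_simps)
  then show ?thesis using q_gt_1 by (auto simp: power2_eq_1_iff)
qed

text \<open>Here \<open>{u, v}\<close> spans a line, whose perp has \<open>q\<^sup>2 * z\<close>
  vectors. Tightness asks for a surplus of \<open>q\<^sup>2 * z\<close> or 0 over the first summand,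
  which amounts to \<open>c(u, v) = A + z\<close> or \<open>c(u, v) = A\<close>.\<close>

lemma card_cover_points_perp_noncollinear:
  fixes z A T :: real
  assumes z: "N = q ^ 4 * z" and A: "A * (q\<^sup>2 - 1) = m * (z - 1)" and T: "T * (q\<^sup>2 - 1) = q\<^sup>2 * z - 1"
    and uv: "\<not> collinear_pair u v"
  shows "card {Q \<in> cover_points CARD('a) h b L. Q \<subseteq> unitary_perp CARD('a) h b (vec.span {comb u v})}
    = (m * (q\<^sup>2 - q) + q + 1) * T + q\<^sup>2 * (card (perp_lines u v) - A)"
proof -
  let ?n = "real (card {Q \<in> cover_points CARD('a) h b L. Q \<subseteq> unitary_perp CARD('a) h b (vec.span {comb u v})})"
  let ?c = "real (card (perp_lines u v))"
  have "real (card (perp b {u, v})) = q\<^sup>2 * z"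
    using card_perp_line[OF span_pair_in_lines[OF uv]] q_gt_1
    by (simp add: perp_span[OF form] z power_numeral_reduce power2_eq_square)
  then have "?n * (q\<^sup>2 - 1) = (q\<^sup>2 - 1) * (card L + q\<^sup>2 * ?c) - (real m - 1) * ((q + 1) * (q\<^sup>2 * z - 1))"
    using card_cover_points_perp[of u v] by simp
  also have "\<dots> = card L * (q\<^sup>2 - 1) + q\<^sup>2 * ?c * (q\<^sup>2 - 1) - (real m - 1) * ((q + 1) * (q\<^sup>2 * z - 1))"
    by algebra
  also have "\<dots> = m * (q ^ 4 * z - 1) + q\<^sup>2 * ?c * (q\<^sup>2 - 1) - (real m - 1) * ((q + 1) * (q\<^sup>2 * z - 1))"
    using card_L by (simp add: z)
  also have "\<dots> = (m * (q\<^sup>2 - q) + q + 1) * (T * (q\<^sup>2 - 1)) + q\<^sup>2 * ?c * (q\<^sup>2 - 1) - q\<^sup>2 * (A * (q\<^sup>2 - 1))"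
    unfolding T A by algebra
  finally have "?n * (q\<^sup>2 - 1) = ((m * (q\<^sup>2 - q) + q + 1) * T + q\<^sup>2 * (?c - A)) * (q\<^sup>2 - 1)"
    by (simp add: algebra_simps)
  then show ?thesis using q_gt_1 by (auto simp: power2_eq_1_iff)
qed

lemma span_comb_in_cover_points_iff:
  assumes "u \<noteq> 0 \<or> v \<noteq> 0"
  shows "vec.span {comb u v} \<in> cover_points CARD('a) h b L \<longleftrightarrow> collinear_pair u v \<or> vec.span {u, v} \<in> L"
proof -
  have "vec.span {comb u v} \<in> cover_points CARD('a) h b L \<longleftrightarrow> (\<exists>k\<in>L. u \<in> k \<and> v \<in> k)"
    using assms by (simp add: span_in_cover_points_iff comb_eq_0_iff comb_in_extended_line)
  then show ?thesis unfolding ex_line_through_pair_iff[OF assms] .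
qed

text \<open>The Hermitian value at \<open>comb u v\<close> is
  \<open>(w ^ CARD('a) - w) * h (b u v)\<close>. This makes tightness applicable at the points of
  the extended lines of the cover.\<close>

lemma span_comb_in_hermitian:
  assumes "u \<noteq> 0 \<or> v \<noteq> 0" "b u v = 0"
  shows "vec.span {comb u v} \<in> hermitian_variety CARD('a) h b"
proof -
  have "b v u = 0" using form_swap[OF form, of v u] assms by simp
  then have "B (comb u v) (tau CARD('a) (comb u v)) = 0"
    unfolding tau_comb using assms
    by (simp add: comb_def extend_form_add_left extend_form_add_right extend_form_scale_left
        extend_form_scale_right B_E h_0 form_self[OF form])
  then have "\<forall>x\<in>vec.span {comb u v}. B x (tau CARD('a) x) = 0"
    by (auto simp: vec.span_singleton tau_scale extend_form_scale_left extend_form_scale_right)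
  then show ?thesis
    using assms by (simp add: hermitian_variety_def span_singleton_in_points comb_eq_0_iff)
qed

lemma tight_iff_dual:
  assumes "r \<ge> 3" "odd r" "CARD('n) = r + 1"
  shows "tight_set r CARD('a) h b (m * (CARD('a)\<^sup>2 - CARD('a)) + CARD('a) + 1) (cover_points CARD('a) h b L)
    \<longleftrightarrow> dual_symplectic_type r CARD('a) b m L"
proof -
  define z where "z = q ^ (r - 3)"
  define A where "A = real m * real (theta (int r - 4) CARD('a)) / (q + 1)"
  define T where "T = real (theta ((int r - 3) div 2) (CARD('a)\<^sup>2))"
  let ?X = "cover_points CARD('a) h b L"
  let ?n = "\<lambda>P. card {Q \<in> ?X. Q \<subseteq> unitary_perp CARD('a) h b P}"
  have z: "N = q ^ 4 * z"
    using assms by (simp add: N_eq z_def flip: power_add)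
  \<comment> \<open>Writing \<open>r = 2 * j + 3\<close> makes \<open>(int r - 3) div 2 = j\<close>
    exact and turns powers of \<open>q\<^sup>2\<close> into powers of \<open>q\<close>.\<close>
  obtain i where "r = 2 * i + 1" using \<open>odd r\<close> by (rule oddE)
  then have "r = 2 * (i - 1) + 3" using \<open>r \<ge> 3\<close> by simp
  then obtain j where j: "r = 2 * j + 3" by blast
  have "nat (int r - 4 + 1) = 2 * j" by (simp add: j)
  then have "real (theta (int r - 4) CARD('a)) * (q - 1) = z - 1"
    using theta_eq[of "int r - 4" "CARD('a)"] by (simp add: z_def j)
  moreover have "A * (q + 1) = m * real (theta (int r - 4) CARD('a))"
    using q_gt_1 by (simp add: A_def)
  ultimately have A: "A * (q\<^sup>2 - 1) = m * (z - 1)" by algebra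
  have "T * (q\<^sup>2 - 1) = (q\<^sup>2) ^ nat (int j + 1) - 1"
    using theta_eq[of "int j" "CARD('a)\<^sup>2"] by (simp add: T_def j)
  also have "(q\<^sup>2) ^ nat (int j + 1) = q\<^sup>2 * z"
    by (simp add: z_def j nat_add_distrib flip: power_mult)
  finally have T: "T * (q\<^sup>2 - 1) = q\<^sup>2 * z - 1" .
  have i: "real (m * (CARD('a)\<^sup>2 - CARD('a)) + CARD('a) + 1) = m * (q\<^sup>2 - q) + q + 1"
    by (simp add: of_nat_diff power2_eq_square)
  have zr: "q ^ (r - 1) = q\<^sup>2 * z"
    by (simp add: z_def j flip: power_add)
  have tight: "tight_set r CARD('a) h b (m * (CARD('a)\<^sup>2 - CARD('a)) + CARD('a) + 1) ?X \<longleftrightarrow>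
    (\<forall>P\<in>hermitian_variety CARD('a) h b.
      real (?n P) = (m * (q\<^sup>2 - q) + q + 1) * T + q\<^sup>2 * z * of_bool (P \<in> ?X))"
  proof -
    have X: "?X \<subseteq> hermitian_variety CARD('a) h b" by (auto simp: cover_points_def)
    let ?i = "m * (CARD('a)\<^sup>2 - CARD('a)) + CARD('a) + 1"
    let ?t = "theta ((int r - 3) div 2) (CARD('a)\<^sup>2)"
    have *: "real (if P \<in> ?X then ?i * ?t + CARD('a) ^ (r - 1) else ?i * ?t)
        = (m * (q\<^sup>2 - q) + q + 1) * T + q\<^sup>2 * z * of_bool (P \<in> ?X)" for P
      unfolding T_def i[symmetric] zr[symmetric]
      by (simp only: real_CARD_power of_nat_add of_nat_mult of_bool_def split: if_split) simp
    have "?n P = (if P \<in> ?X then ?i * ?t + CARD('a) ^ (r - 1) else ?i * ?t)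
      \<longleftrightarrow> real (?n P) = (m * (q\<^sup>2 - q) + q + 1) * T + q\<^sup>2 * z * of_bool (P \<in> ?X)" for P
      by (simp only: *[symmetric] of_nat_eq_iff)
    then show ?thesis unfolding tight_set_def using X by simp
  qed
  \<comment> \<open>Lines are parametrized by the noncollinear pairs that span them; the perp of a
    line depends only on such a pair.\<close>
  have dual: "dual_symplectic_type r CARD('a) b m L \<longleftrightarrow>
    (\<forall>u v. \<not> collinear_pair u v \<longrightarrow> real (card (perp_lines u v)) = A + z * of_bool (vec.span {u, v} \<in> L))"
    (is "_ \<longleftrightarrow> ?dual")
  proof -
    have "dual_symplectic_type r CARD('a) b m L \<longleftrightarrow>
      (\<forall>l\<in>pg_lines. real (card {k \<in> L. k \<subseteq> perp b l}) = A + z * of_bool (l \<in> L))"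
      by (simp add: dual_symplectic_type_def A_def z_def)
    also have "\<dots> \<longleftrightarrow> ?dual"
    proof -
      have c: "card {k \<in> L. k \<subseteq> perp b (vec.span {u, v})} = card (perp_lines u v)" for u v
        by (simp only: perp_lines_def perp_span[OF form])
      show ?thesis
      proof (intro iffI allI impI ballI)
        fix u v :: "'a ^ 'n" assume d: "\<forall>l\<in>pg_lines. real (card {k \<in> L. k \<subseteq> perp b l}) = A + z * of_bool (l \<in> L)"
          and uv: "\<not> collinear_pair u v"
        show "real (card (perp_lines u v)) = A + z * of_bool (vec.span {u, v} \<in> L)"
          using d[rule_format, OF span_pair_in_lines[OF uv]] by (simp only: c)
      next
        fix l :: "('a ^ 'n) set" assume d: ?dual and "l \<in> pg_lines"
        then obtain u v where "\<not> collinear_pair u v" "l = vec.span {u, v}"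
          by (blast elim: pg_line_spanE)
        then show "real (card {k \<in> L. k \<subseteq> perp b l}) = A + z * of_bool (l \<in> L)"
          using d by (simp only: c simp_thms)
      qed
    qed
    finally show ?thesis .
  qed
  show ?thesis unfolding tight dual
  proof
    assume t: "\<forall>P\<in>hermitian_variety CARD('a) h b.
      real (?n P) = (m * (q\<^sup>2 - q) + q + 1) * T + q\<^sup>2 * z * of_bool (P \<in> ?X)"
    have inside: "real (card (perp_lines u v)) = A + z"
      if uv: "\<not> collinear_pair u v" and l: "vec.span {u, v} \<in> L" for u v
    proof -
      have nz: "u \<noteq> 0 \<or> v \<noteq> 0" using uv by (auto simp: collinear_pair_def)
      have "b u v = 0" using l by (intro L_isotropic[OF l]) (auto intro: vec.span_base)
      then have "vec.span {comb u v} \<in> hermitian_variety CARD('a) h b"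
        using nz by (rule span_comb_in_hermitian[rotated])
      then have "q\<^sup>2 * z = q\<^sup>2 * (card (perp_lines u v) - A)"
        using t card_cover_points_perp_noncollinear[OF z A T uv] span_comb_in_cover_points_iff[OF nz] l
        by simp
      then show ?thesis using q_gt_1 by simp
    qed
    \<comment> \<open>Tightness has fixed the count for the lines in \<open>L\<close>; the vanishing
      variance settles all other lines, totally isotropic or not.\<close>
    show ?dual
      using inside card_perp_lines_outside[OF z A inside] by simp
  next
    assume d: ?dual
    show "\<forall>P\<in>hermitian_variety CARD('a) h b.
      real (?n P) = (m * (q\<^sup>2 - q) + q + 1) * T + q\<^sup>2 * z * of_bool (P \<in> ?X)"
    proof
      fix P assume "P \<in> hermitian_variety CARD('a) h b"
      then have "P \<in> pg_points" by (simp add: hermitian_variety_def)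
      then obtain x where x: "x \<noteq> 0" "P = vec.span {x}" by (rule pg_point_spanE)
      obtain u v where xuv: "x = comb u v" by (rule comb_surj)
      have nz: "u \<noteq> 0 \<or> v \<noteq> 0" using x xuv by (auto simp: comb_0)
      show "real (?n P) = (m * (q\<^sup>2 - q) + q + 1) * T + q\<^sup>2 * z * of_bool (P \<in> ?X)"
      proof (cases "collinear_pair u v")
        case True
        then show ?thesis
          using card_cover_points_perp_collinear[OF z A T True nz] span_comb_in_cover_points_iff[OF nz]
          by (simp add: x xuv)
      next
        case False
        then show ?thesis
          using card_cover_points_perp_noncollinear[OF z A T False] span_comb_in_cover_points_iff[OF nz] d
          by (simp add: x xuv)
      qed
    qed
  qed
qed

end

theorem theorem3p2:
  fixes r q m :: nat
    and h :: "'a::{field,finite} \<Rightarrow> 'b::{field,finite}"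
    and b :: "'a ^ 'n::finite \<Rightarrow> 'a ^ 'n \<Rightarrow> 'a"
    and L :: "('a ^ 'n) set set"
  assumes "r \<ge> 3" and "odd r" and "CARD('n) = r + 1"
    and "CARD('a) = q" and "CARD('b) = q\<^sup>2" and "field_hom h"
    and "nondegenerate_alternating b"
    and "m_cover b m L"
  shows "tight_set r q h b (m * (q\<^sup>2 - q) + q + 1) (cover_points q h b L)
     \<longleftrightarrow> dual_symplectic_type r q b m L"
proof -
  \<comment> \<open>The image of \<open>h\<close> has at most \<open>q\<close> elements, fewer than
    \<open>q\<^sup>2\<close>, which supplies the element \<open>w\<close> outside the
    subfield.\<close>
  have "card (range h) \<le> CARD('a)" by (rule card_image_le) simp
  also have "\<dots> < CARD('b)"
    using assms(4,5) card_field_gt_1[where 'k = 'a] by (simp add: power2_eq_square)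
  finally have "range h \<noteq> UNIV" by auto
  then obtain w where "w \<notin> range h" by blast
  then interpret cover_extension b m L "real q" "real q ^ CARD('n)" h w
    using assms by unfold_locales auto
  show ?thesis using tight_iff_dual[OF assms(1-3)] by (simp only: assms(4))
qed

end
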